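(* Let $p$ be a prime and $a$ an integer with $a\not\equiv 0\pmod p$. Then the Heilbronn sum $S(a)=\sum_{n=1}^{p}e^{2\pi i\, a n^p/p^2}$ satisfies $$|S(a)|\ll p^{5/6}\log^{1/6}p ,$$ with an absolute implied constant.
   Context: Logarithms are base 2. *)

theory Defs
  imports "HOL-Analysis.Analysis" "HOL-Number_Theory.Cong"
begin

definition heilbronn_sum :: "nat \<Rightarrow> int \<Rightarrow> complex" where
  "heilbronn_sum p a =
     (\<Sum>n=1..p. exp (2 * of_real pi * \<i> * of_int a * of_nat n ^ p / of_nat p ^ 2))"

end

theory Submission
  imports Defs "HOL-Computational_Algebra.Polynomial" "HOL-Library.Real_Mod"
begin

text \<open>
  Put \<open>N = p\<^sup>2\<close>, let \<open>\<Gamma>\<close> be the group of \<open>p\<close>-th powers modulo \<open>N\<close> and \<open>S\<close> the sum over \<open>\<Gamma>\<close>.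
  The matrix \<open>M(\<gamma>, \<delta>) = e(a \<gamma> \<delta> / N)\<close> has all row and column sums equal to \<open>S\<close>, so Cauchy-Schwarz applied to \<open>M M\<^sup>* M\<close> gives \<open>|S|\<^sup>6 \<le> tr (M M\<^sup>*)\<^sup>3\<close>. That trace is a bilinear form in the
  Fourier matrix of \<open>(\<int>/N)\<^sup>2\<close>, hence at most \<open>N E\<close>, where \<open>E\<close> counts the solutions of
  \<open>\<gamma>\<^sub>1 - \<delta>\<^sub>1 = \<gamma>\<^sub>2 - \<delta>\<^sub>2 = \<gamma>\<^sub>3 - \<delta>\<^sub>3\<close> in \<open>\<Gamma>\<close>.

  Since \<open>k\<^sup>p - (k - 1)\<^sup>p = 1 - p f(k)\<close> for an integer polynomial \<open>f\<close>, the number \<open>E\<close> is governed by the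
  cubes of the sizes of the fibres of \<open>f\<close> modulo \<open>p\<close>. Stepanov's method in the form of Heath-Brown and
  Konyagin bounds the union of \<open>r\<close> fibres by \<open>O((p r)\<^bsup>2/3\<^esup>)\<close>: a nonzero combination of the polynomials
  \<open>X\<^sup>a f\<^sup>b (X - 1)\<^bsup>p c\<^esup>\<close> is made to vanish to high order on these fibres. Summing over the level
  sets yields \<open>E = O(p\<^sup>3 log p)\<close>.

  All polynomials have integer coefficients and are considered modulo the prime element \<open>p\<close> of \<open>\<int>[X]\<close>,
  as there is no type of residues modulo a variable \<open>p\<close>.
\<close>

section \<open>Integer polynomials modulo a prime\<close>

lemma const_poly_dvd_imp_dvd_poly: "[:c:] dvd P \<Longrightarrow> c dvd poly P x"
  for c :: "'a::comm_ring_1"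
  by (auto elim!: dvdE)

lemma const_poly_dvd_pderiv: "[:c:] dvd P \<Longrightarrow> [:c:] dvd pderiv P"
  for c :: int
proof (elim dvdE)
  fix Q assume "P = [:c:] * Q"
  then have "pderiv P = [:c:] * pderiv Q" by (simp add: pderiv_smult)
  then show ?thesis by (metis dvd_triv_left)
qed

text \<open>Leibniz rule: only two terms survive because a linear factor has vanishing second
  derivative. At \<open>j = 0\<close> the truncated \<open>j - 1\<close> is harmless, its
  coefficient being 0.\<close>

lemma higher_pderiv_linear_mult:
  "(pderiv ^^ j) ([:-k, 1:] * Q) =
     [:-k, 1:] * (pderiv ^^ j) Q + smult (int j) ((pderiv ^^ (j - 1)) Q)"
proof (induction j)
  case (Suc j)
  have "(pderiv ^^ Suc j) ([:-k, 1:] * Q) =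
      pderiv ([:-k, 1:] * (pderiv ^^ j) Q + smult (int j) ((pderiv ^^ (j - 1)) Q))"
    by (simp only: funpow.simps o_apply Suc.IH)
  also have "\<dots> = [:-k, 1:] * pderiv ((pderiv ^^ j) Q) + (pderiv ^^ j) Q
      + smult (int j) (pderiv ((pderiv ^^ (j - 1)) Q))"
    by (simp add: pderiv_add pderiv_diff pderiv_smult pderiv_pCons)
  also have "smult (int j) (pderiv ((pderiv ^^ (j - 1)) Q)) = smult (int j) ((pderiv ^^ j) Q)"
    by (cases j) auto
  finally show ?case by (simp add: smult_add_left)
qed simp

text \<open>Induct on the order: in the two-term Leibniz formula the lower-order term is already
  divisible by p, and the remaining factor \<open>x - k\<close> is a unit modulo p.\<close>

lemma higher_pderiv_cancel_linear:
  fixes Q :: "int poly" and p :: nat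
  assumes "prime p" "\<not> int p dvd x - k"
    and "\<And>j. j < D \<Longrightarrow> int p dvd poly ((pderiv ^^ j) ([:-k, 1:] * Q)) x"
    and "j < D"
  shows "int p dvd poly ((pderiv ^^ j) Q) x"
  using \<open>j < D\<close>
proof (induction j)
  case 0
  have "int p dvd (x - k) * poly Q x"
    using assms(3)[of 0] 0 by (simp add: algebra_simps)
  then show ?case
    using assms(1,2) by (simp add: prime_dvd_mult_iff)
next
  case (Suc j)
  have "int p dvd (x - k) * poly ((pderiv ^^ Suc j) Q) x + int (Suc j) * poly ((pderiv ^^ j) Q) x"
    using assms(3)[OF Suc.prems] unfolding higher_pderiv_linear_mult by (simp add: algebra_simps)
  moreover have "int p dvd int (Suc j) * poly ((pderiv ^^ j) Q) x"
    using Suc by (intro dvd_mult) auto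
  ultimately have "int p dvd (x - k) * poly ((pderiv ^^ Suc j) Q) x"
    by (simp only: dvd_add_left_iff)
  then show ?case
    using assms(1,2) by (simp add: prime_dvd_mult_iff)
qed

text \<open>Dividing by \<open>X - k\<close> modulo p at a point of positive order lowers both the
  total order and the degree by one. Orders of at most p keep the factors \<open>j + 1\<close>,
  which Leibniz produces at \<open>k\<close> itself, units modulo p.\<close>

lemma sum_vanishing_orders_le_degree:
  fixes P :: "int poly" and S :: "int set" and m :: "int \<Rightarrow> nat"
  assumes "prime p" "finite S"
    and "\<And>k l. k \<in> S \<Longrightarrow> l \<in> S \<Longrightarrow> k \<noteq> l \<Longrightarrow> \<not> int p dvd k - l"
    and "\<And>k. k \<in> S \<Longrightarrow> m k \<le> p"
    and "\<And>k j. k \<in> S \<Longrightarrow> j < m k \<Longrightarrow> int p dvd poly ((pderiv ^^ j) P) k"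
    and "\<not> [:int p:] dvd P"
  shows "(\<Sum>k\<in>S. m k) \<le> degree P"
  using assms(4-6)
proof (induction "\<Sum>k\<in>S. m k" arbitrary: m P)
  case (Suc N)
  have "\<exists>k\<in>S. m k \<noteq> 0"
    using Suc.hyps(2) by (metis nat.distinct(1) sum.neutral)
  then obtain k where k: "k \<in> S" "m k \<noteq> 0" by blast
  define Q where "Q = synthetic_div P k"
  define c where "c = poly P k"
  \<comment> \<open>The remainder is the value at \<open>k\<close>, a multiple of p, so modulo p
    nothing is lost by passing to \<open>Q\<close>.\<close>
  have P: "P = [:-k, 1:] * Q + [:c:]"
    using synthetic_div_correct'[of k P] unfolding Q_def c_def by simp
  have c: "int p dvd c"
    using Suc.prems(2)[OF k(1), of 0] k(2) by (simp add: c_def)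
  have Q: "\<not> [:int p:] dvd Q"
  proof
    assume "[:int p:] dvd Q"
    then have "[:int p:] dvd P"
      unfolding P using c by (intro dvd_add dvd_mult) (auto simp: const_poly_dvd_const_poly_iff)
    with Suc.prems(3) show False ..
  qed
  then have "Q \<noteq> 0" by auto
  have deg: "Suc (degree Q) \<le> degree P"
  proof -
    have "degree ([:-k, 1:] * Q) = Suc (degree Q)"
      using \<open>Q \<noteq> 0\<close> by (subst degree_mult_eq) auto
    then have "degree P = Suc (degree Q)"
      unfolding P by (subst degree_add_eq_left) auto
    then show ?thesis by simp
  qed
  have vanish: "int p dvd poly ((pderiv ^^ j) ([:-k, 1:] * Q)) l" if "l \<in> S" "j < m l" for l j
  proof -
    have "(pderiv ^^ j) ([:-k, 1:] * Q) = (pderiv ^^ j) P - (pderiv ^^ j) [:c:]"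
      by (simp add: P higher_pderiv_add)
    moreover have "[:int p:] dvd (pderiv ^^ i) [:c:]" for i
      by (induction i) (auto simp: c const_poly_dvd_const_poly_iff const_poly_dvd_pderiv)
    ultimately show ?thesis
      using Suc.prems(2)[OF that] by (simp add: const_poly_dvd_imp_dvd_poly)
  qed
  define m' where "m' = m(k := m k - 1)"
  have sum: "(\<Sum>l\<in>S. m l) = Suc (\<Sum>l\<in>S. m' l)"
    using k by (simp add: sum.remove[OF \<open>finite S\<close> k(1)] m'_def)
  have "(\<Sum>l\<in>S. m' l) \<le> degree Q"
  proof (rule Suc.hyps(1))
    show "N = (\<Sum>l\<in>S. m' l)" using sum Suc.hyps(2) by simp
    show "m' l \<le> p" if "l \<in> S" for l
      using Suc.prems(1)[OF that] by (auto simp: m'_def intro: le_trans[OF diff_le_self])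
    show "int p dvd poly ((pderiv ^^ j) Q) l" if l: "l \<in> S" "j < m' l" for l j
    proof (cases "l = k")
      case True
      then have "Suc j < m k" using l by (simp add: m'_def)
      then have "int p dvd int (Suc j) * poly ((pderiv ^^ j) Q) k"
        using vanish[OF k(1), of "Suc j"] unfolding higher_pderiv_linear_mult by simp
      moreover have "\<not> int p dvd int (Suc j)"
        using \<open>Suc j < m k\<close> Suc.prems(1)[OF k(1)] by (metis dvd_imp_le int_dvd_int_iff
            linorder_not_less order_less_le_trans zero_less_Suc)
      ultimately show ?thesis
        using \<open>prime p\<close> True by (simp add: prime_dvd_mult_iff del: of_nat_Suc)
    next
      case False
      show ?thesis
        by (rule higher_pderiv_cancel_linear[OF \<open>prime p\<close> _ _ l(2)])
          (use False l k assms(3) vanish in \<open>auto simp: m'_def\<close>)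
    qed
    show "\<not> [:int p:] dvd Q" by (rule Q)
  qed
  then show ?case using sum deg Suc.hyps(2) by simp
qed simp

text \<open>Pigeonhole in place of a dimension count over the field of p elements: there are more
  vectors with entries below p than possible images, and the difference of two vectors with the same
  image is a nontrivial solution.\<close>

lemma pigeonhole_linear_system_mod:
  fixes M :: "'j \<Rightarrow> 'i \<Rightarrow> int" and p :: nat
  assumes "finite I" "finite J" "card J < card I" "p > 1"
  obtains x where "\<And>j. j \<in> J \<Longrightarrow> int p dvd (\<Sum>i\<in>I. M j i * x i)"
    and "\<exists>i\<in>I. \<not> int p dvd x i"
proof -
  define F where "F = (\<lambda>x. \<lambda>j\<in>J. (\<Sum>i\<in>I. M j i * x i) mod int p)"
  let ?A = "PiE I (\<lambda>_. {0..<int p})" and ?B = "PiE J (\<lambda>_. {0..<int p})"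
  have "F ` ?A \<subseteq> ?B"
    using assms by (auto simp: F_def)
  then have "card (F ` ?A) \<le> card ?B"
    using assms by (intro card_mono finite_PiE) auto
  also have "\<dots> = p ^ card J" using assms by (simp add: card_PiE)
  also have "\<dots> < p ^ card I" using assms by simp
  also have "\<dots> = card ?A" using assms by (simp add: card_PiE)
  finally have "\<not> inj_on F ?A" by (rule pigeonhole)
  then obtain x y where xy: "x \<in> ?A" "y \<in> ?A" "F x = F y" "x \<noteq> y"
    by (auto simp: inj_on_def)
  show ?thesis
  proof (rule that)
    fix j assume "j \<in> J"
    then have "(\<Sum>i\<in>I. M j i * x i) mod int p = (\<Sum>i\<in>I. M j i * y i) mod int p"
      using fun_cong[OF xy(3), of j] by (simp add: F_def)
    then show "int p dvd (\<Sum>i\<in>I. M j i * (x i - y i))"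
      by (simp add: right_diff_distrib sum_subtractf mod_eq_dvd_iff)
  next
    obtain i where i: "i \<in> I" "x i \<noteq> y i"
      using xy by (meson PiE_ext)
    have "x i \<in> {0..<int p}" "y i \<in> {0..<int p}" using xy i by auto
    then have "x i mod int p \<noteq> y i mod int p" using i by simp
    then show "\<exists>i\<in>I. \<not> int p dvd x i - y i"
      using i mod_eq_dvd_iff by blast
  qed
qed


lemma smult_sum_right: "smult c (sum g I) = (\<Sum>i\<in>I. smult c (g i))"
  by (induction I rule: infinite_finite_induct) (simp_all add: smult_add_right)

section \<open>The polynomial of Heilbronn's sum and Stepanov's method\<close>

definition X :: "int poly" where "X = [:0, 1:]"

lemma pderiv_X [simp]: "pderiv X = 1"
  by (simp add: X_def pderiv_pCons)

lemma poly_X [simp]: "poly X k = k"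
  by (simp add: X_def)

lemma degree_X_power_mult_le: "degree (X ^ a * (X - 1) ^ c) \<le> a + c"
proof -
  have "degree (X ^ a) \<le> 1 * a" "degree ((X - 1) ^ c) \<le> 1 * c"
    by (rule order.trans[OF degree_power_le], simp add: X_def one_pCons)+
  then show ?thesis
    using degree_mult_le[of "X ^ a" "(X - 1) ^ c"] by linarith
qed

text \<open>In the binomial expansion the inner coefficients are divisible by p; oddness of p makes
  the two end terms \<open>X ^ p\<close> and \<open>-1\<close> cancel against the rest.\<close>

lemma prime_dvd_one_minus_power_plus:
  assumes "prime p" "odd p"
  shows "of_nat p dvd 1 - X ^ p + (X - 1) ^ p"
proof -
  let ?g = "\<lambda>k. of_nat (p choose k) * X ^ k * (-1) ^ (p - k)"
  have "p > 0" using assms by (simp add: prime_gt_0_nat)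
  have "(X - 1) ^ p = (X + (-1)) ^ p" by simp
  also have "\<dots> = (\<Sum>k\<le>p. ?g k)" by (rule binomial_ring)
  also have "{..p} = insert 0 (insert p {0<..<p})" by auto
  also have "sum ?g \<dots> = -1 + X ^ p + sum ?g {0<..<p}"
    using \<open>p > 0\<close> \<open>odd p\<close> by simp
  finally have "1 - X ^ p + (X - 1) ^ p = sum ?g {0<..<p}" by simp
  moreover have "of_nat p dvd ?g k" if "k \<in> {0<..<p}" for k
  proof -
    have "p dvd (p choose k)"
      using that assms by (intro dvd_choose_prime) auto
    then have "(of_nat p :: int poly) dvd of_nat (p choose k)" by (auto elim!: dvdE)
    then show ?thesis by (simp add: dvd_mult2)
  qed
  ultimately show ?thesis by (metis (no_types, lifting) dvd_sum)
qed

text \<open>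
  Away from 0 and 1, vanishing to order \<open>D\<close> can be tested with iterates of this operator instead of
  derivatives.
\<close>

definition theta :: "int poly \<Rightarrow> int poly" where
  "theta P = X * (1 - X) * pderiv P"

lemma theta_add: "theta (P + Q) = theta P + theta Q"
  by (simp add: theta_def pderiv_add algebra_simps)

lemma theta_diff: "theta (P - Q) = theta P - theta Q"
  by (simp add: theta_def pderiv_diff algebra_simps)

lemma theta_smult: "theta (smult c P) = smult c (theta P)"
  by (simp add: theta_def pderiv_smult)

lemma theta_mult: "theta (P * Q) = theta P * Q + P * theta Q"
  by (simp add: theta_def pderiv_mult algebra_simps)

lemma theta_power: "theta (P ^ n) = of_nat n * P ^ (n - 1) * theta P"
  by (simp add: theta_def pderiv_power of_nat_poly mult_ac)

lemma theta_X_power: "theta (X ^ a) = of_nat a * (X ^ a - X ^ (a + 1))"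
  unfolding theta_power by (cases a) (simp_all add: theta_def algebra_simps)

lemma funpow_theta_add: "(theta ^^ n) (P + Q) = (theta ^^ n) P + (theta ^^ n) Q"
  by (induction n) (simp_all add: theta_add)

lemma funpow_theta_diff: "(theta ^^ n) (P - Q) = (theta ^^ n) P - (theta ^^ n) Q"
  by (induction n) (simp_all add: theta_diff)

lemma funpow_theta_smult: "(theta ^^ n) (smult c P) = smult c ((theta ^^ n) P)"
  by (induction n) (simp_all add: theta_smult)

lemma funpow_theta_of_nat: "(theta ^^ n) (of_nat m * P) = of_nat m * (theta ^^ n) P"
  using funpow_theta_smult[of n "int m" P] by (simp add: of_nat_poly)

lemma funpow_theta_sum: "(theta ^^ n) (sum g I) = (\<Sum>i\<in>I. (theta ^^ n) (g i))"
proof (induction I rule: infinite_finite_induct)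
  case (insert i I)
  then show ?case by (simp add: funpow_theta_add)
next
  case empty
  show ?case using funpow_theta_smult[of n 0 0] by simp
next
  case (infinite I)
  then show ?case using funpow_theta_smult[of n 0 0] by simp
qed

lemma of_nat_dvd_funpow_theta: "of_nat m dvd P \<Longrightarrow> of_nat m dvd (theta ^^ n) P"
  by (elim dvdE) (simp add: funpow_theta_of_nat)

lemma dvd_poly_of_of_nat_dvd: "of_nat m dvd P \<Longrightarrow> int m dvd poly P k"
  by (auto elim!: dvdE)

text \<open>\<open>theta P\<close> is the product of \<open>X\<close>, \<open>X - 1\<close> and
  \<open>- pderiv P\<close>, and the two linear factors are units at \<open>k\<close>. Cancelling
  them turns orders of \<open>theta P\<close> into orders of \<open>pderiv P\<close>, and induction
  on \<open>D\<close> finishes.\<close>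

lemma higher_pderiv_vanishes_of_theta_vanishes:
  fixes p :: nat
  assumes "prime p" "\<not> int p dvd k" "\<not> int p dvd k - 1"
    and "\<And>n. n < D \<Longrightarrow> int p dvd poly ((theta ^^ n) P) k"
    and "j < D"
  shows "int p dvd poly ((pderiv ^^ j) P) k"
  using assms(4,5)
proof (induction D arbitrary: P j)
  case (Suc D)
  have th: "theta P = [:-0, 1:] * ([:-1, 1:] * (- pderiv P))"
    by (simp add: theta_def X_def one_pCons)
  have 1: "int p dvd poly ((pderiv ^^ i) (theta P)) k" if "i < D" for i
  proof (rule Suc.IH[OF _ that])
    fix n assume "n < D"
    then show "int p dvd poly ((theta ^^ n) (theta P)) k"
      using Suc.prems(1)[of "Suc n"] by (simp add: funpow_swap1)
  qed
  have 2: "int p dvd poly ((pderiv ^^ i) ([:-1, 1:] * (- pderiv P))) k" if "i < D" for i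
    by (rule higher_pderiv_cancel_linear[where k = 0 and D = D, OF assms(1) _ _ that])
      (use assms(2) 1 in \<open>simp_all only: th diff_zero not_False_eq_True\<close>)
  have *: "int p dvd poly ((pderiv ^^ i) (- pderiv P)) k" if "i < D" for i
    by (rule higher_pderiv_cancel_linear[where k = 1 and D = D, OF assms(1) _ _ that])
      (use assms(3) 2 in \<open>simp_all only: not_False_eq_True\<close>)
  show ?case
  proof (cases j)
    case 0
    then show ?thesis using Suc.prems(1)[of 0] by simp
  next
    case (Suc i)
    have "(pderiv ^^ i) (- pderiv P) = - (pderiv ^^ Suc i) P"
      using higher_pderiv_smult[of i "-1" "pderiv P"] by (simp add: funpow_swap1)
    then show ?thesis using *[of i] Suc Suc.prems(2) by simp
  qed
qed simp

text \<open>
  On a point \<open>k\<close> of \<open>{2..<p}\<close> with \<open>f(k) \<equiv> u\<close>, the polynomial \<open>reduct n a b c u\<close> takes the same value modulo \<open>p\<close>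
  as the \<open>n\<close>-fold iterate of \<open>theta\<close> on \<open>X\<^sup>a f\<^sup>b (X - 1)\<^bsup>p c\<^esup>\<close>, but its degree does not grow with \<open>p\<close>. The
  recursion expresses \<open>theta f \<equiv> (X - 1) - (X - 1)\<^sup>p\<close> and \<open>theta ((X - 1)\<^sup>p) \<equiv> 0\<close>.
\<close>

primrec reduct :: "nat \<Rightarrow> nat \<Rightarrow> nat \<Rightarrow> nat \<Rightarrow> int \<Rightarrow> int poly" where
  "reduct 0 a b c u = smult (u ^ b) (X ^ a * (X - 1) ^ c)"
| "reduct (Suc n) a b c u =
     smult (int a) (reduct n a b c u - reduct n (a + 1) b c u)
   + smult (int b) (reduct n (a + 1) (b - 1) c u - reduct n a (b - 1) c u
                    - reduct n a (b - 1) (c + 1) u)"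

text \<open>Each step of the recursion raises \<open>a\<close> or \<open>c\<close> by at most one. A
  bound free of p and \<open>b\<close> keeps the number of linear conditions in Stepanov's method
  small.\<close>

lemma degree_reduct_le: "degree (reduct n a b c u) \<le> a + c + n"
proof (induction n arbitrary: a b c)
  case 0
  show ?case
    using degree_X_power_mult_le[of a c] degree_smult_le[of "u ^ b" "X ^ a * (X - 1) ^ c"]
    by simp
next
  case (Suc n)
  have "degree (reduct n a b c u) \<le> a + c + Suc n"
    "degree (reduct n (a + 1) b c u) \<le> a + c + Suc n"
    "degree (reduct n (a + 1) (b - 1) c u) \<le> a + c + Suc n"
    "degree (reduct n a (b - 1) c u) \<le> a + c + Suc n"
    "degree (reduct n a (b - 1) (c + 1) u) \<le> a + c + Suc n"
    using Suc.IH[of a b c] Suc.IH[of "a + 1" b c] Suc.IH[of "a + 1" "b - 1" c]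
      Suc.IH[of a "b - 1" c] Suc.IH[of a "b - 1" "c + 1"] by linarith+
  then show ?case
    unfolding reduct.simps
    by (intro degree_add_le degree_diff_le order.trans[OF degree_smult_le])
qed

text \<open>Consecutive cubes differ by at most \<open>3 * j ^ 2\<close>; this prepares the
  summation over level sets of the fibre sizes.\<close>

lemma cube_le_sum_squares: "(n::nat) ^ 3 \<le> (\<Sum>j=1..n. 3 * j ^ 2)"
proof (induction n)
  case (Suc n)
  then show ?case by (simp add: power_numeral_reduce algebra_simps)
qed simp

lemma harm_le: "n > 0 \<Longrightarrow> harm n \<le> 1 + ln (real n)"
  using decseqD[OF decseq_harm_diff_ln, of 0 "n - 1"] by (simp add: harm_def)

section \<open>The polynomial f modulo p and the operator theta on Stepanov's monomials\<close>

text \<open>Modulo p, \<open>f\<close> is the truncated logarithm X + X^2/2 + ... + X^(p-1)/(p-1);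
  it is given through its multiple by p to stay over the integers.\<close>

locale heilbronn_poly =
  fixes p :: nat and f :: "int poly"
  assumes prime_p: "prime p" and odd_p: "odd p"
    and p_times_f: "of_nat p * f = 1 - X ^ p + (X - 1) ^ p"
begin

lemma p_gt_1: "p > 1" and p_pos: "p > 0"
  using prime_p prime_gt_1_nat[of p] by auto

lemma pderiv_f: "pderiv f = (X - 1) ^ (p - 1) - X ^ (p - 1)"
proof -
  have "of_nat p * pderiv f = pderiv (of_nat p * f)"
    by (simp add: pderiv_mult)
  also have "\<dots> = of_nat p * ((X - 1) ^ (p - 1) - X ^ (p - 1))"
    unfolding p_times_f
    by (simp add: pderiv_add pderiv_diff pderiv_power of_nat_poly algebra_simps smult_diff_right)
  finally show ?thesis
    using p_pos by simp
qed

text \<open>Modulo p and up to order \<open>p - 1\<close> at 1, the operator X d/dX sends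
  \<open>f\<close> to -1, just as it does -log X.\<close>

lemma X_pderiv_f: "X * pderiv f = (X - 1) ^ (p - 1) - 1 + of_nat p * f"
proof -
  have "X ^ p = X * X ^ (p - 1)" "(X - 1) ^ p = (X - 1) * (X - 1) ^ (p - 1)"
    using p_pos by (simp_all flip: power_Suc)
  then show ?thesis
    unfolding pderiv_f p_times_f by (simp add: algebra_simps)
qed

lemma theta_f: "theta f = (X - 1) - (X - 1) ^ p - (X - 1) * of_nat p * f"
proof -
  have "(X - 1) ^ p = (X - 1) * (X - 1) ^ (p - 1)"
    using p_pos by (simp_all flip: power_Suc)
  moreover have "theta f = (1 - X) * (X * pderiv f)"
    by (simp add: theta_def)
  ultimately show ?thesis
    unfolding X_pderiv_f by (simp add: algebra_simps)
qed

text \<open>Fermat's little theorem, read off from the identity for \<open>f\<close>: modulo p it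
  gives k^p - (k-1)^p = 1, so induction runs in both directions from 0.\<close>

lemma fermat: "int p dvd k ^ p - k"
proof (induction k rule: int_induct[where k = 0])
  case base
  show ?case using p_pos by (simp add: zero_power)
next
  case (step1 i)
  have "int p * poly f (i + 1) = 1 - (i + 1) ^ p + i ^ p"
    using arg_cong[OF p_times_f, of "\<lambda>P. poly P (i + 1)"] by simp
  then have "(i + 1) ^ p - (i + 1) = (i ^ p - i) - int p * poly f (i + 1)" by simp
  then show ?case using step1 by (metis dvd_diff dvd_triv_left)
next
  case (step2 i)
  have "int p * poly f i = 1 - i ^ p + (i - 1) ^ p"
    using arg_cong[OF p_times_f, of "\<lambda>P. poly P i"] by simp
  then have "(i - 1) ^ p - (i - 1) = (i ^ p - i) + int p * poly f i" by simp
  then show ?case using step2 by (metis dvd_add dvd_triv_left)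
qed

lemma degree_f_le: "degree f \<le> p"
proof -
  have "degree f = degree (of_nat p * f)"
    using p_pos by (simp add: of_nat_poly)
  also have "\<dots> \<le> p"
    unfolding p_times_f
    using degree_X_power_mult_le[of p 0] degree_X_power_mult_le[of 0 p]
    by (intro degree_add_le degree_diff_le) simp_all
  finally show ?thesis .
qed

text \<open>The building blocks of Stepanov's auxiliary polynomial. The last factor raises the
  degree by \<open>p * c\<close>, yet \<open>theta\<close> maps it to 0 modulo p, and at an integer
  \<open>k\<close> it reduces to \<open>(k - 1) ^ c\<close> by Fermat.\<close>

definition mon :: "nat \<Rightarrow> nat \<Rightarrow> nat \<Rightarrow> int poly" where
  "mon a b c = X ^ a * f ^ b * (X - 1) ^ (p * c)"

lemma degree_mon_le: "degree (mon a b c) \<le> a + p * b + p * c"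
proof -
  have "degree (f ^ b) \<le> p * b"
    using degree_power_le[of f b] degree_f_le by (meson mult_le_mono1 order.trans)
  moreover have "degree (mon a b c) \<le> degree (X ^ a * (X - 1) ^ (p * c)) + degree (f ^ b)"
    using degree_mult_le[of "X ^ a * (X - 1) ^ (p * c)" "f ^ b"]
    by (simp add: mon_def mult_ac)
  ultimately show ?thesis
    using degree_X_power_mult_le[of a "p * c"] by linarith
qed

text \<open>Product rule with \<open>theta_f\<close>. What remains are multiples of p: the
  derivative of \<open>(X - 1) ^ (p * c)\<close> and the p-term of \<open>theta f\<close>. For
  \<open>b = 0\<close> the truncated \<open>b - 1\<close> carries coefficient 0.\<close>

lemma theta_mon:
  "of_nat p dvd theta (mon a b c) -
     (of_nat a * (mon a b c - mon (a + 1) b c)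
    + of_nat b * (mon (a + 1) (b - 1) c - mon a (b - 1) c - mon a (b - 1) (c + 1)))"
proof -
  have *: "theta (mon a b c) = theta (X ^ a) * f ^ b * (X - 1) ^ (p * c)
      + X ^ a * theta (f ^ b) * (X - 1) ^ (p * c) + X ^ a * f ^ b * theta ((X - 1) ^ (p * c))"
    by (simp add: mon_def theta_mult algebra_simps)
  have W: "(X - 1) ^ (p * (c + 1)) = (X - 1) ^ (p * c) * (X - 1) ^ p"
    by (simp add: power_add)
  have "theta (mon a b c) - (of_nat a * (mon a b c - mon (a + 1) b c)
      + of_nat b * (mon (a + 1) (b - 1) c - mon a (b - 1) c - mon a (b - 1) (c + 1)))
    = of_nat p * (X ^ a * f ^ b * (of_nat c * (X - 1) ^ (p * c - 1) * theta (X - 1))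
        - X ^ a * (of_nat b * f ^ (b - 1) * (X - 1) * f) * (X - 1) ^ (p * c))"
    unfolding *
    unfolding theta_X_power theta_power[of f] theta_f theta_power[of "X - 1"] mon_def W
    by (simp add: algebra_simps)
  then show ?thesis by simp
qed

text \<open>Iterating \<open>theta_mon\<close> reproduces the recursion of \<open>reduct\<close>,
  since multiples of p stay so under \<open>theta\<close>. In the base case f(k) becomes
  \<open>u\<close> and Fermat replaces \<open>(k - 1) ^ p\<close> by \<open>k - 1\<close>.\<close>

lemma reduct_correct:
  assumes "int p dvd poly f k - u"
  shows "int p dvd poly ((theta ^^ n) (mon a b c)) k - poly (reduct n a b c u) k"
proof (induction n arbitrary: a b c)
  case 0
  have "[poly f k = u] (mod int p)" "[(k - 1) ^ p = k - 1] (mod int p)"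
    using assms fermat by (simp_all add: cong_iff_dvd_diff)
  then have "[k ^ a * poly f k ^ b * ((k - 1) ^ p) ^ c = k ^ a * u ^ b * (k - 1) ^ c] (mod int p)"
    by (intro cong_mult cong_pow cong_refl)
  then show ?case
    by (simp add: mon_def cong_iff_dvd_diff mult_ac flip: power_mult)
next
  case (Suc n)
  define E where "E = theta (mon a b c) - (of_nat a * (mon a b c - mon (a + 1) b c)
    + of_nat b * (mon (a + 1) (b - 1) c - mon a (b - 1) c - mon a (b - 1) (c + 1)))"
  have E: "int p dvd poly ((theta ^^ n) E) k"
    unfolding E_def by (intro dvd_poly_of_of_nat_dvd of_nat_dvd_funpow_theta theta_mon)
  have "theta (mon a b c) = E + (of_nat a * (mon a b c - mon (a + 1) b c)
    + of_nat b * (mon (a + 1) (b - 1) c - mon a (b - 1) c - mon a (b - 1) (c + 1)))"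
    by (simp add: E_def)
  then have "(theta ^^ Suc n) (mon a b c) = (theta ^^ n) E +
    (of_nat a * ((theta ^^ n) (mon a b c) - (theta ^^ n) (mon (a + 1) b c))
    + of_nat b * ((theta ^^ n) (mon (a + 1) (b - 1) c) - (theta ^^ n) (mon a (b - 1) c)
       - (theta ^^ n) (mon a (b - 1) (c + 1))))"
    by (simp only: funpow_Suc_right o_apply funpow_theta_add funpow_theta_diff funpow_theta_of_nat)
  then have "poly ((theta ^^ Suc n) (mon a b c)) k - poly (reduct (Suc n) a b c u) k =
     poly ((theta ^^ n) E) k
    + (int a * ((poly ((theta ^^ n) (mon a b c)) k - poly (reduct n a b c u) k)
              - (poly ((theta ^^ n) (mon (a + 1) b c)) k - poly (reduct n (a + 1) b c u) k))
    + int b * ((poly ((theta ^^ n) (mon (a + 1) (b - 1) c)) k - poly (reduct n (a + 1) (b - 1) c u) k)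
              - (poly ((theta ^^ n) (mon a (b - 1) c)) k - poly (reduct n a (b - 1) c u) k)
              - (poly ((theta ^^ n) (mon a (b - 1) (c + 1))) k - poly (reduct n a (b - 1) (c + 1) u) k)))"
    by (simp only: reduct.simps poly_add poly_diff poly_mult poly_of_nat poly_smult) (simp add: algebra_simps)
  then show ?case
    using E Suc.IH by (simp only: dvd_add dvd_diff dvd_mult)
qed

section \<open>Independence of the monomials through vanishing at 1\<close>

text \<open>Divisibility by \<open>(X - 1) ^ s\<close> over the field of p elements, phrased as
  membership in an ideal of integer polynomials.\<close>

definition vanishes_at_1 :: "nat \<Rightarrow> int poly \<Rightarrow> bool" where
  "vanishes_at_1 s P \<longleftrightarrow> (\<exists>Q R. P = (X - 1) ^ s * Q + of_nat p * R)"

lemma vanishes_at_1_add: "vanishes_at_1 s P \<Longrightarrow> vanishes_at_1 s Q \<Longrightarrow> vanishes_at_1 s (P + Q)"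
  unfolding vanishes_at_1_def
proof (elim exE)
  fix A B C D
  assume "P = (X - 1) ^ s * A + of_nat p * B" "Q = (X - 1) ^ s * C + of_nat p * D"
  then have "P + Q = (X - 1) ^ s * (A + C) + of_nat p * (B + D)" by (simp add: algebra_simps)
  then show "\<exists>A B. P + Q = (X - 1) ^ s * A + of_nat p * B" by blast
qed

lemma vanishes_at_1_mult: "vanishes_at_1 s P \<Longrightarrow> vanishes_at_1 s (Q * P)"
  unfolding vanishes_at_1_def
proof (elim exE)
  fix A B
  assume "P = (X - 1) ^ s * A + of_nat p * B"
  then have "Q * P = (X - 1) ^ s * (Q * A) + of_nat p * (Q * B)" by (simp add: algebra_simps)
  then show "\<exists>A B. Q * P = (X - 1) ^ s * A + of_nat p * B" by blast
qed

lemma vanishes_at_1_diff: "vanishes_at_1 s P \<Longrightarrow> vanishes_at_1 s Q \<Longrightarrow> vanishes_at_1 s (P - Q)"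
  using vanishes_at_1_add[of s P "(-1) * Q"] vanishes_at_1_mult[of s Q "-1"] by simp

lemma vanishes_at_1_smult: "vanishes_at_1 s P \<Longrightarrow> vanishes_at_1 s (smult c P)"
  using vanishes_at_1_mult[of s P "[:c:]"] by simp

lemma vanishes_at_1_power: "s \<le> n \<Longrightarrow> vanishes_at_1 s ((X - 1) ^ n)"
  unfolding vanishes_at_1_def
  by (rule exI[of _ "(X - 1) ^ (n - s)"], rule exI[of _ 0]) (simp flip: power_add)

lemma vanishes_at_1_p: "vanishes_at_1 s (of_nat p)"
  unfolding vanishes_at_1_def by (rule exI[of _ 0], rule exI[of _ 1]) simp

lemma vanishes_at_1_sum: "(\<And>i. i \<in> I \<Longrightarrow> vanishes_at_1 s (g i)) \<Longrightarrow> vanishes_at_1 s (sum g I)"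
proof (induction I rule: infinite_finite_induct)
  case (insert i I)
  then show ?case by (auto intro: vanishes_at_1_add)
qed (use vanishes_at_1_mult[OF vanishes_at_1_p, of s 0] in auto)

lemma vanishes_at_1_mono: "s \<le> s' \<Longrightarrow> vanishes_at_1 s' P \<Longrightarrow> vanishes_at_1 s P"
proof -
  assume "s \<le> s'" "vanishes_at_1 s' P"
  then obtain Q R where P: "P = Q * (X - 1) ^ s' + R * of_nat p"
    by (auto simp: vanishes_at_1_def mult.commute)
  show ?thesis
    unfolding P using \<open>s \<le> s'\<close>
    by (intro vanishes_at_1_add vanishes_at_1_mult vanishes_at_1_power vanishes_at_1_p)
qed

lemma vanishes_at_1_pderiv:
  assumes "vanishes_at_1 (Suc s) P"
  shows "vanishes_at_1 s (pderiv P)"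
proof -
  obtain Q R where P: "P = (X - 1) ^ Suc s * Q + of_nat p * R"
    using assms vanishes_at_1_def by blast
  have "pderiv P = (X - 1) ^ s * (of_nat (Suc s) * Q + (X - 1) * pderiv Q) + of_nat p * pderiv R"
    unfolding P
    by (simp add: pderiv_add pderiv_diff pderiv_mult pderiv_power_Suc pderiv_smult of_nat_poly algebra_simps
        del: power_Suc of_nat_Suc) (simp add: algebra_simps)
  then show ?thesis using vanishes_at_1_def by blast
qed

lemma vanishes_at_1_poly: "vanishes_at_1 (Suc s) P \<Longrightarrow> int p dvd poly P 1"
  by (auto simp: vanishes_at_1_def)

definition combo :: "nat \<Rightarrow> nat \<Rightarrow> (nat \<Rightarrow> nat \<Rightarrow> int) \<Rightarrow> int poly" where
  "combo A B c = (\<Sum>a<A. \<Sum>b<B. smult (c a b) (X ^ a * f ^ b))"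

text \<open>Up to p and \<open>(X - 1) ^ (p - 1)\<close>, the operator X d/dX -
  \<open>a\<^sub>0\<close> maps X^a f^b to (a - \<open>a\<^sub>0\<close>) X^a f^b - b X^a f^(b-1),
  as for -log X in place of \<open>f\<close>; the new coefficients collect equal powers of
  \<open>f\<close>. The condition \<open>s < p\<close> absorbs the error.\<close>

lemma euler_operator_combo:
  assumes "\<And>a. a < A \<Longrightarrow> c a B = 0" "s < p"
  shows "vanishes_at_1 s (X * pderiv (combo A B c) - of_nat a\<^sub>0 * combo A B c
     - combo A B (\<lambda>a b. (int a - int a\<^sub>0) * c a b - int (b + 1) * c a (b + 1)))"
proof -
  define m where "m a b = X ^ a * f ^ b" for a b
  have mon: "vanishes_at_1 s (X * pderiv (m a b) - (smult (int a) (m a b) - smult (int b) (m a (b - 1))))"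
    (is "vanishes_at_1 s ?E") for a b
  proof -
    have "X * pderiv (X ^ a) = smult (int a) (X ^ a)"
      by (cases a) (simp_all add: pderiv_power mult_ac flip: power_Suc)
    moreover have "X * pderiv (f ^ b) = smult (int b) (f ^ (b - 1)) * (X * pderiv f)"
      by (simp add: pderiv_power algebra_simps)
    moreover have "X * pderiv (m a b) = (X * pderiv (X ^ a)) * f ^ b + X ^ a * (X * pderiv (f ^ b))"
      by (simp add: m_def pderiv_mult algebra_simps)
    ultimately have eq: "X * pderiv (m a b) = smult (int a) (X ^ a) * f ^ b
        + X ^ a * (smult (int b) (f ^ (b - 1)) * ((X - 1) ^ (p - 1) - 1 + of_nat p * f))"
      by (simp only: X_pderiv_f)
    have "?E = smult (int b) (m a (b - 1)) * (X - 1) ^ (p - 1)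
        + (smult (int b) (m a (b - 1)) * f) * of_nat p"
      unfolding eq by (simp add: m_def algebra_simps smult_add_right smult_diff_right)
    moreover have "s \<le> p - 1" using \<open>s < p\<close> by simp
    ultimately show ?thesis
      by (simp only: vanishes_at_1_add vanishes_at_1_mult vanishes_at_1_power vanishes_at_1_p)
  qed
  \<comment> \<open>Shifting \<open>b\<close> by one creates no boundary terms: at the bottom the
    factor \<open>int b\<close> is 0, at the top \<open>c a B\<close> is 0.\<close>
  have shift: "(\<Sum>b<B. smult (c a b) (smult (int b) (m a (b - 1)))) =
      (\<Sum>b<B. smult (int (b + 1) * c a (b + 1)) (m a b))" if "a < A" for a
  proof -
    have "(\<Sum>b<B. smult (c a b) (smult (int b) (m a (b - 1)))) =
       (\<Sum>b<Suc B. smult (c a b) (smult (int b) (m a (b - 1))))"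
      using assms(1)[OF that] by simp
    also have "\<dots> = (\<Sum>b<B. smult (int (b + 1) * c a (b + 1)) (m a b))"
      by (simp add: sum.lessThan_Suc_shift mult.commute del: sum.lessThan_Suc)
    finally show ?thesis .
  qed
  have "X * pderiv (combo A B c) - of_nat a\<^sub>0 * combo A B c
     - combo A B (\<lambda>a b. (int a - int a\<^sub>0) * c a b - int (b + 1) * c a (b + 1))
    = X * pderiv (combo A B c) - (\<Sum>a<A. (\<Sum>b<B. smult (int a * c a b) (m a b))
         - (\<Sum>b<B. smult (int (b + 1) * c a (b + 1)) (m a b)))"
    by (simp add: combo_def m_def of_nat_poly smult_diff_left left_diff_distrib sum_subtractf
        smult_add_left sum.distrib smult_sum_right algebra_simps del: of_nat_Suc)
  also have "\<dots> = X * pderiv (combo A B c) - (\<Sum>a<A. (\<Sum>b<B. smult (int a * c a b) (m a b))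
         - (\<Sum>b<B. smult (c a b) (smult (int b) (m a (b - 1)))))"
    by (rule arg_cong2[where f = "(-)", OF refl], rule sum.cong)
      (simp_all only: shift lessThan_iff)
  also have "\<dots> = (\<Sum>a<A. \<Sum>b<B. smult (c a b)
      (X * pderiv (m a b) - (smult (int a) (m a b) - smult (int b) (m a (b - 1)))))"
    by (simp add: combo_def higher_pderiv_sum[of 1, simplified] pderiv_smult sum_distrib_left sum_subtractf sum.distrib
       m_def smult_diff_right smult_add_right mult.commute)
  finally show ?thesis
    using mon by (simp only:) (intro vanishes_at_1_sum vanishes_at_1_smult)
qed


lemma p_dvd_of_dvd_small_mult:
  assumes "int p dvd int n * x" "0 < n" "n < p"
  shows "int p dvd x"
  using assms prime_p by (auto simp: prime_dvd_mult_iff dest: dvd_imp_le)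

text \<open>
  Near \<open>X = 1\<close> the polynomial \<open>f\<close> behaves like \<open>- log X\<close>. The operator \<open>X d/dX - a\<^sub>0\<close> lowers the vanishing order
  at 1 by at most one, and lowers by one the number \<open>h a\<^sub>0\<close> of powers of \<open>f\<close> that occur with \<open>X\<^bsup>a\<^sub>0\<^esup>\<close>.
\<close>

lemma combo_coeffs_vanish:
  assumes "A \<le> p" "B \<le> p" "s \<le> p"
    and "\<And>a. a < A \<Longrightarrow> h a \<le> B"
    and "\<And>a b. a < A \<Longrightarrow> h a \<le> b \<Longrightarrow> c a b = 0"
    and "(\<Sum>a<A. h a) \<le> s"
    and "vanishes_at_1 s (combo A B c)"
    and "a < A"
  shows "int p dvd c a b"
  using assms(3-)
proof (induction s arbitrary: h c a b)
  case 0
  then have "h a = 0" by simp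
  then show ?case using 0 by simp
next
  case (Suc s)
  show ?case
  proof (cases "(\<Sum>a<A. h a) \<le> s")
    case True
    show ?thesis
      by (rule Suc.IH[where h = h])
        (use Suc.prems True vanishes_at_1_mono[of s "Suc s"] in auto)
  next
    case False
    then obtain a\<^sub>0 where a\<^sub>0: "a\<^sub>0 < A" "h a\<^sub>0 > 0"
      by (metis (no_types, lifting) gr0I lessThan_iff sum.neutral zero_le)
    define h' where "h' = h(a\<^sub>0 := h a\<^sub>0 - 1)"
    define c' where "c' = (\<lambda>a b. (int a - int a\<^sub>0) * c a b - int (b + 1) * c a (b + 1))"
    have c': "int p dvd c' a b" if "a < A" for a b
    proof (rule Suc.IH[where h = h'])
      show "s \<le> p" using Suc.prems by simp
      show "h' a \<le> B" if "a < A" for a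
        using Suc.prems(2)[OF that] by (auto simp: h'_def)
      show "c' a b = 0" if "a < A" "h' a \<le> b" for a b
        using that Suc.prems(3)[of a b] Suc.prems(3)[of a "b + 1"]
        by (cases "a = a\<^sub>0") (auto simp: h'_def c'_def)
      have "(\<Sum>a<A. h a) = Suc (\<Sum>a<A. h' a)"
        using a\<^sub>0 by (simp add: sum.remove[of "{..<A}" a\<^sub>0] h'_def)
      then show "(\<Sum>a<A. h' a) \<le> s" using Suc.prems(4) by simp
      have "vanishes_at_1 s (X * pderiv (combo A B c) - of_nat a\<^sub>0 * combo A B c)"
        using Suc.prems(5) vanishes_at_1_mono[of s "Suc s"]
        by (intro vanishes_at_1_diff vanishes_at_1_mult vanishes_at_1_pderiv) auto
      moreover have "vanishes_at_1 s (X * pderiv (combo A B c) - of_nat a\<^sub>0 * combo A B c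
          - combo A B c')"
        unfolding c'_def using Suc.prems(1-3) by (intro euler_operator_combo) auto
      ultimately show "vanishes_at_1 s (combo A B c')"
        using vanishes_at_1_diff by fastforce
    qed (rule that)
    \<comment> \<open>Here \<open>c'\<close> links \<open>b\<close> to \<open>b + 1\<close> with
      leading factor \<open>int a - int a\<^sub>0\<close>, a unit because \<open>A \<le> p\<close>.
      Descend from \<open>b = h a\<close>, where the coefficient is 0.\<close>
    have nonzero_exponent: "int p dvd c a b" if a: "a < A" "a \<noteq> a\<^sub>0" for a b
    proof -
      have "int p dvd c a b" if "b \<le> h a"
        using that
      proof (induction b rule: inc_induct)
        case base
        then show ?case using Suc.prems(3)[of a "h a"] a by simp
      next
        case (step b)
        have "int p dvd (int a - int a\<^sub>0) * c a b"
          using c'[OF a(1), of b] step by (simp add: c'_def dvd_diff_left_iff del: of_nat_Suc)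
        moreover have "\<not> int p dvd int a - int a\<^sub>0"
          using a a\<^sub>0 \<open>A \<le> p\<close> dvd_imp_le_int[of "int a - int a\<^sub>0" "int p"] by auto
        ultimately show ?case using prime_p by (simp add: prime_dvd_mult_iff)
      qed
      then show ?thesis using Suc.prems(3)[of a b] a by (cases "b \<le> h a") auto
    qed
    \<comment> \<open>On the row \<open>a\<^sub>0\<close> the first term of \<open>c'\<close> drops
      out, leaving \<open>- int (b + 1) * c a\<^sub>0 (b + 1)\<close>; this controls every
      coefficient of the row but the one at 0.\<close>
    have positive_log: "int p dvd c a\<^sub>0 (Suc b)" for b
    proof (cases "Suc b < h a\<^sub>0")
      case True
      have "int p dvd int (Suc b) * c a\<^sub>0 (Suc b)"
        using c'[OF a\<^sub>0(1), of b] by (simp add: c'_def)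
      then show ?thesis
        using True Suc.prems(2)[OF a\<^sub>0(1)] \<open>B \<le> p\<close>
        by (auto intro: p_dvd_of_dvd_small_mult[of "Suc b"] simp del: of_nat_Suc)
    next
      case False
      then show ?thesis using Suc.prems(3)[OF a\<^sub>0(1)] by simp
    qed
    \<comment> \<open>The last coefficient is the value at 1 modulo p, since all others are already
      multiples of p.\<close>
    have "int p dvd c a\<^sub>0 0"
    proof -
      have "poly (combo A B c) 1 = (\<Sum>a<A. \<Sum>b<B. c a b * poly f 1 ^ b)"
        by (simp add: combo_def poly_sum)
      also have "\<dots> = (\<Sum>(a, b)\<in>{..<A} \<times> {..<B}. c a b * poly f 1 ^ b)"
        by (simp add: sum.cartesian_product)
      also have "\<dots> = c a\<^sub>0 0 + (\<Sum>(a, b)\<in>{..<A} \<times> {..<B} - {(a\<^sub>0, 0)}. c a b * poly f 1 ^ b)"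
        using a\<^sub>0 Suc.prems(2)[OF a\<^sub>0(1)] by (subst sum.remove[of _ "(a\<^sub>0, 0)"]) auto
      finally have "poly (combo A B c) 1 =
        c a\<^sub>0 0 + (\<Sum>(a, b)\<in>{..<A} \<times> {..<B} - {(a\<^sub>0, 0)}. c a b * poly f 1 ^ b)" .
      moreover have "int p dvd (\<Sum>(a, b)\<in>{..<A} \<times> {..<B} - {(a\<^sub>0, 0)}. c a b * poly f 1 ^ b)"
      proof (rule dvd_sum)
        fix ab assume "ab \<in> {..<A} \<times> {..<B} - {(a\<^sub>0, 0)}"
        then obtain a b where ab: "ab = (a, b)" "a < A" "(a, b) \<noteq> (a\<^sub>0, 0)" by blast
        show "int p dvd (case ab of (a, b) \<Rightarrow> c a b * poly f 1 ^ b)"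
          using nonzero_exponent[OF ab(2)] positive_log ab(3) unfolding ab(1)
          by (cases b; cases "a = a\<^sub>0") auto
      qed
      ultimately show ?thesis
        using vanishes_at_1_poly[OF Suc.prems(5)] by (simp add: dvd_add_left_iff)
    qed
    then show ?thesis
      using nonzero_exponent[OF Suc.prems(6)] positive_log
      by (cases "a = a\<^sub>0"; cases b) auto
  qed
qed

lemma prime_elem_p: "prime_elem (of_nat p :: int poly)"
  using prime_p by (simp add: of_nat_poly prime_elem_const_poly_iff)

lemma not_p_dvd_power: "\<not> of_nat p dvd (X - 1) ^ n"
proof
  assume "of_nat p dvd (X - 1) ^ n"
  then have "of_nat p dvd X - 1" using prime_elem_p prime_elem_dvd_power by blast
  then have "int p dvd poly (X - 1) 2" by (rule dvd_poly_of_of_nat_dvd)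
  then show False using p_gt_1 by simp
qed

text \<open>Induct on \<open>C\<close>. Modulo \<open>(X - 1) ^ p\<close> only the block
  \<open>c = 0\<close> remains, so it vanishes to order p at 1, and
  \<open>combo_coeffs_vanish\<close> with \<open>h\<close> constantly \<open>B\<close> applies by
  \<open>A * B \<le> p\<close>. The other blocks share a factor \<open>(X - 1) ^ p\<close>, which
  cancels as p is a prime element not dividing it.\<close>

lemma mon_combination_coeffs_vanish:
  assumes "A * B \<le> p" "A > 0" "B > 0"
    and "of_nat p dvd (\<Sum>c<C. (X - 1) ^ (p * c) * combo A B (x c))"
    and "\<And>c a b. c < C \<Longrightarrow> a < A \<Longrightarrow> B \<le> b \<Longrightarrow> x c a b = 0"
    and "c < C" "a < A"
  shows "int p dvd x c a b"
  using assms(4-)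
proof (induction C arbitrary: x c)
  case (Suc C)
  define T where "T = (\<Sum>c<C. (X - 1) ^ (p * c) * combo A B (x (Suc c)))"
  have T: "(\<Sum>c<Suc C. (X - 1) ^ (p * c) * combo A B (x c)) = combo A B (x 0) + (X - 1) ^ p * T"
    by (simp add: sum.lessThan_Suc_shift T_def sum_distrib_left power_add algebra_simps
        del: sum.lessThan_Suc)
  with Suc.prems(1) have dvd: "of_nat p dvd combo A B (x 0) + (X - 1) ^ p * T" by simp
  then obtain R where "combo A B (x 0) + (X - 1) ^ p * T = of_nat p * R" by (elim dvdE)
  then have "combo A B (x 0) = (X - 1) ^ p * (- T) + of_nat p * R"
    by (simp add: algebra_simps)
  then have vanish: "vanishes_at_1 p (combo A B (x 0))"
    using vanishes_at_1_def by blast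
  have "A \<le> A * B" "B \<le> A * B" using assms(2,3) by auto
  then have "A \<le> p" "B \<le> p" using assms(1) by linarith+
  have x0: "int p dvd x 0 a b" if "a < A" for a b
    by (rule combo_coeffs_vanish[where h = "\<lambda>_. B" and s = p, OF \<open>A \<le> p\<close> \<open>B \<le> p\<close>])
      (use vanish that Suc.prems(2) assms(1) in \<open>simp_all\<close>)
  show ?case
  proof (cases c)
    case 0
    then show ?thesis using x0 Suc.prems by simp
  next
    case (Suc c')
    have "of_nat p dvd combo A B (x 0)"
      unfolding combo_def using x0
      by (intro dvd_sum) (auto simp: of_nat_poly const_poly_dvd_iff)
    then have "of_nat p dvd (X - 1) ^ p * T" using dvd by (simp only: dvd_add_right_iff)
    then have "of_nat p dvd T"
      using prime_elem_p not_p_dvd_power prime_elem_dvd_mult_iff by blast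
    then show ?thesis
      unfolding Suc T_def using Suc.prems Suc
      by (intro Suc.IH[where x = "\<lambda>c. x (Suc c)"]) auto
  qed
qed simp


text \<open>The unknowns are the \<open>A * B * C\<close> coefficients of the monomials; the
  conditions make the reduced polynomial of every iterate \<open>n < D\<close> vanish identically
  modulo p for each \<open>u\<close> in \<open>U\<close>. The resulting combination is nonzero
  modulo p and has order at least \<open>D\<close> at every point counted, so its degree bounds the
  count.\<close>

lemma stepanov:
  fixes U :: "int set"
  assumes "A * B \<le> p" "finite U" "card U * D * (A + C + D) < A * B * C" "D \<le> p"
  shows "D * card {k \<in> {2..<int p}. \<exists>u\<in>U. int p dvd poly f k - u} \<le> A + p * (B + C)"
proof -
  define S where "S = {k \<in> {2..<int p}. \<exists>u\<in>U. int p dvd poly f k - u}"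
  define I where "I = {..<C} \<times> {..<A} \<times> {..<B}"
  \<comment> \<open>A triple \<open>(u, n, e)\<close> stands for the coefficient of degree
    \<open>e\<close> of the reduced \<open>n\<close>-th iterate over the value \<open>u\<close>;
    \<open>degree_reduct_le\<close> limits \<open>e\<close>.\<close>
  define J where "J = U \<times> {..<D} \<times> {..<A + C + D}"
  have "0 < A" "0 < B" using assms(3) by (auto intro: gr0I)
  have "finite I" "finite J" "card J < card I"
    using assms by (simp_all add: I_def J_def mult_ac)
  then obtain x where
    x: "\<And>j. j \<in> J \<Longrightarrow> int p dvd (\<Sum>i\<in>I. (case j of (u, n, e) \<Rightarrow> case i of (c, a, b) \<Rightarrow>
          coeff (reduct n a b c u) e) * x i)"
    and nz: "\<exists>i\<in>I. \<not> int p dvd x i"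
    using pigeonhole_linear_system_mod[of I J p "\<lambda>j i. case j of (u, n, e) \<Rightarrow> case i of (c, a, b) \<Rightarrow>
          coeff (reduct n a b c u) e"] p_gt_1 by blast
  define \<Psi> where "\<Psi> = (\<Sum>(c, a, b)\<in>I. smult (x (c, a, b)) (mon a b c))"
  have \<Psi>_nz: "\<not> of_nat p dvd \<Psi>"
  proof
    assume dvd: "of_nat p dvd \<Psi>"
    \<comment> \<open>Extension by 0 beyond \<open>B\<close>, as
      \<open>mon_combination_coeffs_vanish\<close> requires.\<close>
    define y where "y = (\<lambda>c a b. if b < B then x (c, a, b) else 0)"
    have "\<Psi> = (\<Sum>c<C. (X - 1) ^ (p * c) * combo A B (y c))"
      unfolding \<Psi>_def I_def combo_def y_def
      by (simp add: sum.cartesian_product[symmetric] sum_distrib_left mon_def mult_ac)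
    with dvd have y: "int p dvd y c a b" if "c < C" "a < A" for c a b
      using that assms(1) \<open>0 < A\<close> \<open>0 < B\<close>
      by (intro mon_combination_coeffs_vanish[where A = A and B = B and C = C and x = y])
        (auto simp: y_def)
    obtain a b c where "c < C" "a < A" "b < B" "\<not> int p dvd x (c, a, b)"
      using nz by (auto simp: I_def)
    then show False using y[of c a b] by (simp add: y_def)
  qed
  have root: "int p dvd poly ((theta ^^ n) \<Psi>) k" if "k \<in> S" "n < D" for k n
  proof -
    obtain u where u: "u \<in> U" "int p dvd poly f k - u" using \<open>k \<in> S\<close> by (auto simp: S_def)
    \<comment> \<open>All coefficients of \<open>P\<close> vanish modulo p, not only its values on
      the fibre, so the number of conditions is independent of the fibre size.\<close>
    define P where "P = (\<Sum>(c, a, b)\<in>I. smult (x (c, a, b)) (reduct n a b c u))"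
    have "int p dvd coeff P e" for e
    proof (cases "e < A + C + D")
      case True
      then have "(u, n, e) \<in> J" using u that by (simp add: J_def)
      from x[OF this] show ?thesis
        by (simp add: P_def coeff_sum case_prod_unfold mult.commute)
    next
      case False
      have "coeff (reduct n a b c u) e = 0" if "(c, a, b) \<in> I" for a b c
        using that False \<open>n < D\<close> degree_reduct_le[of n a b c u]
        by (intro coeff_eq_0) (auto simp: I_def)
      then have "coeff P e = 0"
        unfolding P_def coeff_sum by (intro sum.neutral) auto
      then show ?thesis by simp
    qed
    then have "int p dvd poly P k"
      by (intro const_poly_dvd_imp_dvd_poly) (simp add: const_poly_dvd_iff)
    moreover have "int p dvd poly ((theta ^^ n) \<Psi>) k - poly P k"
    proof -
      have "poly ((theta ^^ n) \<Psi>) k - poly P k = (\<Sum>(c, a, b)\<in>I. x (c, a, b) *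
          (poly ((theta ^^ n) (mon a b c)) k - poly (reduct n a b c u) k))"
        by (simp add: \<Psi>_def P_def funpow_theta_sum poly_sum case_prod_unfold funpow_theta_smult
            sum_subtractf right_diff_distrib)
      then show ?thesis
        using reduct_correct[OF u(2)] by (auto intro!: dvd_sum)
    qed
    ultimately show ?thesis by (simp add: dvd_diff_left_iff)
  qed
  have "(\<Sum>k\<in>S. D) \<le> degree \<Psi>"
  proof (rule sum_vanishing_orders_le_degree[OF prime_p])
    show "finite S" unfolding S_def by (rule finite_subset[of _ "{2..<int p}"]) auto
    show "\<not> int p dvd k - l" if "k \<in> S" "l \<in> S" "k \<noteq> l" for k l
      using that dvd_imp_le_int[of "k - l" "int p"] by (auto simp: S_def)
    show "int p dvd poly ((pderiv ^^ j) \<Psi>) k" if k: "k \<in> S" "j < D" for k j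
    proof (rule higher_pderiv_vanishes_of_theta_vanishes[OF prime_p _ _ root[OF k(1)] k(2)])
      show "\<not> int p dvd k" "\<not> int p dvd k - 1"
        using k by (auto simp: S_def dest!: zdvd_imp_le)
    qed
    show "\<not> [:int p:] dvd \<Psi>" using \<Psi>_nz by (simp add: of_nat_poly)
  qed (rule assms)
  also have "degree \<Psi> \<le> A + p * (B + C)"
    unfolding \<Psi>_def
  proof (rule degree_sum_le)
    fix i assume "i \<in> I"
    then obtain a b c where i: "i = (c, a, b)" "a < A" "b < B" "c < C" by (auto simp: I_def)
    have "p * b \<le> p * B" "p * c \<le> p * C" using i by auto
    then have "degree (smult (x i) (mon a b c)) \<le> A + (p * B + p * C)"
      using degree_smult_le[of "x i" "mon a b c"] degree_mon_le[of a b c] i(2) by linarith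
    then show "degree (case i of (c, a, b) \<Rightarrow> smult (x (c, a, b)) (mon a b c)) \<le> A + p * (B + C)"
      by (simp only: i(1) prod.case distrib_left)
  qed (use \<open>finite I\<close> in simp)
  finally show ?thesis by (simp add: S_def mult.commute)
qed


section \<open>The fibres of the polynomial\<close>

text \<open>The residues 0 and 1 are left out: \<open>theta\<close> carries no information there,
  and in the energy count k = 0 or k = 1 would force a variable to be 0 modulo p.\<close>

definition fibre :: "int \<Rightarrow> int set" where
  "fibre u = {k \<in> {2..<int p}. int p dvd poly f k - u}"

lemma finite_fibre: "finite (fibre u)"
  unfolding fibre_def by (rule finite_subset[of _ "{2..<int p}"]) auto

lemma card_UN_fibre_le: "card (\<Union>u\<in>U. fibre u) \<le> p"
proof -
  have "card (\<Union>u\<in>U. fibre u) \<le> card {2..<int p}"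
    by (rule card_mono) (auto simp: fibre_def)
  then show ?thesis by simp
qed

text \<open>If r = \<open>card U\<close> exceeds the square root of p, the trivial bound p suffices.
  Otherwise Stepanov's method with \<open>C = B\<close> bounds the union by O(p B / D), which is of
  order p r / B, hence (p r)^(2/3).\<close>

lemma card_UN_fibre_cube_le:
  assumes "finite U" "U \<noteq> {}" "p \<ge> 256"
  shows "card (\<Union>u\<in>U. fibre u) ^ 3 \<le> 48 ^ 3 * p ^ 2 * card U ^ 2"
proof -
  define r where "r = card U"
  define N where "N = card (\<Union>u\<in>U. fibre u)"
  have r: "r > 0" using assms by (simp add: r_def card_gt_0_iff)
  have "N ^ 3 \<le> 48 ^ 3 * p ^ 2 * r ^ 2"
  proof (cases "r ^ 2 \<le> p")
    case False
    have "N ^ 3 \<le> p ^ 3" using card_UN_fibre_le by (simp add: N_def power_mono)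
    also have "p ^ 3 = p ^ 2 * p" by (simp add: power_numeral_reduce)
    also have "\<dots> \<le> p ^ 2 * r ^ 2" using False by simp
    also have "\<dots> \<le> 48 ^ 3 * p ^ 2 * r ^ 2" by simp
    finally show ?thesis .
  next
    case True
    \<comment> \<open>\<open>B\<close> is the integer part of \<open>(p r)\<^bsup>1/3\<^esup>\<close>; \<open>A B \<le> p\<close> is the nonvanishing condition and \<open>D\<close> is then
      as large as the number of linear conditions permits.\<close>
    define B where "B = (LEAST n. p * r < Suc n ^ 3)"
    have "p * r < Suc (p * r) ^ 3"
      using self_le_power[of "Suc (p * r)" 3] by simp
    then have B_upper: "p * r < Suc B ^ 3" unfolding B_def by (rule LeastI)
    have "B \<noteq> 0"
      using B_upper r assms(3) by (intro notI) simp
    then have "\<not> p * r < Suc (B - 1) ^ 3"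
      using not_less_Least[of "B - 1" "\<lambda>n. p * r < Suc n ^ 3"] by (simp add: B_def)
    with \<open>B \<noteq> 0\<close> have B_lower: "B ^ 3 \<le> p * r" by simp
    have "Suc B ^ 3 \<le> (2 * B) ^ 3" using \<open>B \<noteq> 0\<close> by (intro power_mono) auto
    then have B8: "p * r < 8 * B ^ 3" using B_upper by (simp add: power_mult_distrib)
    have B_sq: "B ^ 2 \<le> p"
    proof -
      have "(B ^ 2) ^ 3 = (B ^ 3) ^ 2" by (simp flip: power_mult)
      also have "\<dots> \<le> (p * r) ^ 2" using B_lower by (rule power_mono) simp
      also have "\<dots> \<le> p ^ 2 * p" using True by (simp add: power_mult_distrib)
      also have "\<dots> = p ^ 3" by (simp add: power_numeral_reduce)
      finally show ?thesis by (subst (asm) power_mono_iff) auto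
    qed
    \<comment> \<open>This ensures \<open>D > 0\<close>. Its failure together with r^2 \<le> p would
      give p^4 < 4096^2 p = 256^3 p: the origin of the threshold 256.\<close>
    have r4: "4 * r \<le> B ^ 2"
    proof (rule ccontr)
      assume "\<not> 4 * r \<le> B ^ 2"
      then have "(B ^ 2) ^ 3 \<le> (4 * r) ^ 3" by (intro power_mono) auto
      moreover have "(p * r) ^ 2 < (8 * B ^ 3) ^ 2" using B8 by (intro power_strict_mono) auto
      moreover have "(8 * B ^ 3) ^ 2 = 64 * (B ^ 2) ^ 3" by (simp add: power_mult_distrib flip: power_mult)
      ultimately have "(p * r) ^ 2 < 64 * (4 * r) ^ 3" by linarith
      then have "p ^ 2 * r ^ 2 < 4096 * r * r ^ 2"
        by (simp only: power_mult_distrib) (simp add: power_numeral_reduce)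
      then have "p ^ 2 < 4096 * r" using r by simp
      then have "(p ^ 2) ^ 2 < (4096 * r) ^ 2" by (intro power_strict_mono) auto
      also have "\<dots> = 4096 ^ 2 * r ^ 2" by (simp add: power_mult_distrib)
      also have "\<dots> \<le> 4096 ^ 2 * p" using True by simp
      finally have "p ^ 3 * p < 256 ^ 3 * p" by (simp add: power_numeral_reduce)
      then have "p ^ 3 < 256 ^ 3" by simp
      then show False using power_mono[OF assms(3), of 3] by simp
    qed
    define A where "A = p div B"
    define D where "D = B ^ 2 div (4 * r)"
    have "A * B \<le> p" by (simp add: A_def)
    have "B \<le> A"
      using B_sq \<open>B \<noteq> 0\<close> by (simp add: A_def less_eq_div_iff_mult_less_eq power2_eq_square)
    have "D > 0" using r4 r by (simp add: D_def div_greater_zero_iff)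
    have D_upper: "D * (4 * r) \<le> B ^ 2" by (simp add: D_def)
    have "B ^ 2 < 4 * r * (D + 1)"
      using dividend_less_times_div[of "4 * r" "B ^ 2"] r by (simp add: D_def algebra_simps)
    also have "\<dots> \<le> 8 * r * D" using \<open>D > 0\<close> by simp
    finally have D_lower: "B ^ 2 \<le> 8 * r * D" by simp
    have "D \<le> A"
    proof -
      have "(4 * D * B) * r = D * (4 * r) * B" by simp
      also have "\<dots> \<le> B ^ 2 * B" using D_upper by (rule mult_right_mono) simp
      also have "\<dots> \<le> p * r" using B_lower by (simp add: power_numeral_reduce)
      finally have "4 * D * B \<le> p" using r by simp
      then show ?thesis using \<open>B \<noteq> 0\<close> by (simp add: A_def less_eq_div_iff_mult_less_eq)
    qed
    have "D * N \<le> A + p * (B + B)"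
    proof -
      \<comment> \<open>Since \<open>B\<close> and \<open>D\<close> are at most \<open>A\<close>,
        the number of conditions is at most 3 r D A, below 4 r D A \<le> A B^2, the number of
        unknowns.\<close>
      have "r * D * (A + B + D) \<le> r * D * (3 * A)"
        using \<open>B \<le> A\<close> \<open>D \<le> A\<close> by (intro mult_left_mono) auto
      also have "\<dots> < D * (4 * r) * A" using r \<open>D > 0\<close> \<open>D \<le> A\<close> by simp
      also have "\<dots> \<le> B ^ 2 * A" using D_upper by (rule mult_right_mono) simp
      finally have "card U * D * (A + B + D) < A * B * B"
        by (simp add: r_def power2_eq_square mult_ac)
      moreover have "D \<le> p" using \<open>D \<le> A\<close> by (metis A_def div_le_dividend le_trans)
      moreover have "(\<Union>u\<in>U. fibre u) = {k \<in> {2..<int p}. \<exists>u\<in>U. int p dvd poly f k - u}"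
        by (auto simp: fibre_def)
      ultimately show ?thesis
        using stepanov[OF \<open>A * B \<le> p\<close> \<open>finite U\<close>] by (simp only: N_def)
    qed
    also have "\<dots> \<le> 3 * p * B"
    proof -
      have "A \<le> p * B" using \<open>B \<noteq> 0\<close> \<open>A * B \<le> p\<close>
        by (metis A_def div_le_dividend le_trans mult.right_neutral mult_le_mono2 less_one not_less)
      then show ?thesis by (simp add: algebra_simps)
    qed
    finally have DN: "D * N \<le> 3 * p * B" .
    \<comment> \<open>From D N \<le> 3 p B and B^2 \<le> 8 r D follows B N \<le> 24 p r; cubing and
      p r < 8 B^3 give the constant 8 * 24^3 = 48^3.\<close>
    have "B * (B * N) \<le> 8 * r * (D * N)"
      using mult_right_mono[OF D_lower, of N] by (simp add: power2_eq_square mult_ac)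
    also have "\<dots> \<le> 8 * r * (3 * p * B)" using DN by (intro mult_left_mono) auto
    also have "\<dots> = B * (24 * (p * r))" by simp
    finally have "B * N \<le> 24 * (p * r)" using \<open>B \<noteq> 0\<close> by simp
    then have "(B * N) ^ 3 \<le> (24 * (p * r)) ^ 3" by (rule power_mono) simp
    then have "8 * B ^ 3 * N ^ 3 \<le> 8 * (24 * (p * r)) ^ 3" by (simp add: power_mult_distrib)
    moreover have "p * r * N ^ 3 \<le> 8 * B ^ 3 * N ^ 3"
      using B8 by (intro mult_right_mono) auto
    ultimately have "p * r * N ^ 3 \<le> 8 * (24 * (p * r)) ^ 3" by linarith
    also have "\<dots> = p * r * (48 ^ 3 * p ^ 2 * r ^ 2)"
      by (simp add: power_mult_distrib power_numeral_reduce)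
    finally show ?thesis using r p_pos by simp
  qed
  then show ?thesis by (simp add: N_def r_def)
qed

lemma disjoint_fibre:
  assumes "u \<in> {0..<int p}" "v \<in> {0..<int p}" "u \<noteq> v"
  shows "fibre u \<inter> fibre v = {}"
proof (rule ccontr)
  assume "fibre u \<inter> fibre v \<noteq> {}"
  then obtain k where "int p dvd poly f k - u" "int p dvd poly f k - v" by (auto simp: fibre_def)
  then have "int p dvd (poly f k - v) - (poly f k - u)" by (rule dvd_diff[rotated])
  then have "int p dvd u - v" by simp
  then show False using assms dvd_imp_le_int[of "u - v" "int p"] by auto
qed

text \<open>Apply the union bound to the set \<open>U\<close> of values with large fibres:
  disjointness makes the union at least \<open>card U * j\<close>, and \<open>card U ^ 2\<close>
  cancels.\<close>

lemma card_large_fibres_le: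
  assumes "p \<ge> 256"
  shows "j ^ 3 * card {u \<in> {0..<int p}. j \<le> card (fibre u)} \<le> 48 ^ 3 * p ^ 2"
proof -
  define U where "U = {u \<in> {0..<int p}. j \<le> card (fibre u)}"
  have "finite U" unfolding U_def by (rule finite_subset[of _ "{0..<int p}"]) auto
  show ?thesis
  proof (cases "U = {}")
    case False
    have "card U * j = (\<Sum>u\<in>U. j)" by simp
    also have "\<dots> \<le> (\<Sum>u\<in>U. card (fibre u))" by (rule sum_mono) (simp add: U_def)
    also have "\<dots> = card (\<Union>u\<in>U. fibre u)"
      using \<open>finite U\<close> finite_fibre disjoint_fibre
      by (intro card_UN_disjoint[symmetric]) (auto simp: U_def)
    finally have "(card U * j) ^ 3 \<le> card (\<Union>u\<in>U. fibre u) ^ 3" by (rule power_mono) simp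
    also have "\<dots> \<le> 48 ^ 3 * p ^ 2 * card U ^ 2"
      by (rule card_UN_fibre_cube_le[OF \<open>finite U\<close> False assms])
    finally have "(j ^ 3 * card U) * card U ^ 2 \<le> (48 ^ 3 * p ^ 2) * card U ^ 2"
      by (simp add: power_mult_distrib power_numeral_reduce mult_ac)
    moreover have "card U > 0" using False \<open>finite U\<close> by (simp add: card_gt_0_iff)
    ultimately have "j ^ 3 * card U \<le> 48 ^ 3 * p ^ 2" by simp
    then show ?thesis by (simp only: U_def)
  next
    case True
    then have "j ^ 3 * card U \<le> 48 ^ 3 * p ^ 2" by simp
    then show ?thesis by (simp only: U_def)
  qed
qed

text \<open>Layer-cake summation: expand the cubes by \<open>cube_le_sum_squares\<close> and swap.
  The level set at \<open>j\<close> has size O(p^2 / j^3), so the weights \<open>3 * j ^ 2\<close>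
  leave a harmonic sum, the source of the logarithm.\<close>

lemma sum_fibre_cubes_le:
  assumes "p \<ge> 256"
  shows "real (\<Sum>u\<in>{0..<int p}. card (fibre u) ^ 3) \<le> 3 * 48 ^ 3 * real p ^ 2 * (1 + ln (real p))"
proof -
  let ?U = "{0..<int p}"
  have "card (fibre u) \<le> p" for u
    using card_UN_fibre_le[of "{u}"] by simp
  then have "(\<Sum>u\<in>?U. card (fibre u) ^ 3) \<le>
      (\<Sum>u\<in>?U. \<Sum>j=1..p. if j \<le> card (fibre u) then 3 * j ^ 2 else 0)"
  proof (intro sum_mono)
    fix u
    have "card (fibre u) ^ 3 \<le> (\<Sum>j=1..card (fibre u). 3 * j ^ 2)" by (rule cube_le_sum_squares)
    also have "\<dots> = (\<Sum>j\<in>{1..p} \<inter> {j. j \<le> card (fibre u)}. 3 * j ^ 2)"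
      using \<open>card (fibre u) \<le> p\<close> by (intro sum.cong) auto
    also have "\<dots> = (\<Sum>j=1..p. if j \<le> card (fibre u) then 3 * j ^ 2 else 0)"
      by (simp add: sum.inter_restrict)
    finally show "card (fibre u) ^ 3 \<le> \<dots>" .
  qed
  also have "\<dots> = (\<Sum>j=1..p. \<Sum>u\<in>?U. if j \<le> card (fibre u) then 3 * j ^ 2 else 0)"
    by (rule sum.swap)
  also have "\<dots> = (\<Sum>j=1..p. 3 * j ^ 2 * card {u \<in> ?U. j \<le> card (fibre u)})"
    by (simp add: sum.inter_filter[symmetric] mult.commute)
  finally have "real (\<Sum>u\<in>?U. card (fibre u) ^ 3) \<le>
      real (\<Sum>j=1..p. 3 * j ^ 2 * card {u \<in> ?U. j \<le> card (fibre u)})"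
    by (rule of_nat_mono)
  also have "\<dots> = (\<Sum>j=1..p. real (3 * j ^ 2 * card {u \<in> ?U. j \<le> card (fibre u)}))"
    by (rule of_nat_sum)
  also have "\<dots> \<le> (\<Sum>j=1..p. 3 * 48 ^ 3 * real p ^ 2 * inverse (real j))"
  proof (rule sum_mono)
    fix j assume "j \<in> {1..p}"
    then have "real j > 0" by simp
    have "real (j ^ 3 * card {u \<in> ?U. j \<le> card (fibre u)}) \<le> real (48 ^ 3 * p ^ 2)"
      using card_large_fibres_le[OF assms] by (rule of_nat_mono)
    then have "real j * real (3 * j ^ 2 * card {u \<in> ?U. j \<le> card (fibre u)}) \<le> 3 * 48 ^ 3 * real p ^ 2"
      by (simp add: power_numeral_reduce mult_ac)
    then show "real (3 * j ^ 2 * card {u \<in> ?U. j \<le> card (fibre u)}) \<le>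
        3 * 48 ^ 3 * real p ^ 2 * inverse (real j)"
      using \<open>real j > 0\<close> by (simp add: field_simps del: of_nat_mult of_nat_power)
  qed
  also have "\<dots> = 3 * 48 ^ 3 * real p ^ 2 * harm p"
    by (simp add: harm_def sum_distrib_left)
  also have "\<dots> \<le> 3 * 48 ^ 3 * real p ^ 2 * (1 + ln (real p))"
    using harm_le[OF p_pos] by (intro mult_left_mono) auto
  finally show ?thesis .
qed

lemma card_triples_same_value_le:
  assumes "p \<ge> 256"
  shows "real (card {(k\<^sub>1, k\<^sub>2, k\<^sub>3). {k\<^sub>1, k\<^sub>2, k\<^sub>3} \<subseteq> {2..<int p} \<and>
      int p dvd poly f k\<^sub>1 - poly f k\<^sub>2 \<and> int p dvd poly f k\<^sub>1 - poly f k\<^sub>3})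
    \<le> 3 * 48 ^ 3 * real p ^ 2 * (1 + ln (real p))" (is "real (card ?T) \<le> _")
proof -
  let ?U = "{0..<int p}"
  have "?T \<subseteq> (\<Union>u\<in>?U. fibre u \<times> fibre u \<times> fibre u)"
  proof (clarify)
    fix k l m
    assume *: "{k, l, m} \<subseteq> {2..<int p}" "int p dvd poly f k - poly f l" "int p dvd poly f k - poly f m"
    define u where "u = poly f k mod int p"
    have "poly f l mod int p = u" "poly f m mod int p = u"
      using * by (metis u_def mod_eq_dvd_iff)+
    then have "int p dvd poly f k - u" "int p dvd poly f l - u" "int p dvd poly f m - u"
      by (metis u_def dvd_minus_mod)+
    then have "k \<in> fibre u" "l \<in> fibre u" "m \<in> fibre u"
      using *(1) unfolding fibre_def by auto
    moreover have "u \<in> ?U" using p_pos by (simp add: u_def)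
    ultimately show "(k, l, m) \<in> (\<Union>u\<in>?U. fibre u \<times> fibre u \<times> fibre u)" by blast
  qed
  then have "card ?T \<le> card (\<Union>u\<in>?U. fibre u \<times> fibre u \<times> fibre u)"
    by (rule card_mono[rotated]) (simp add: finite_fibre)
  also have "\<dots> \<le> (\<Sum>u\<in>?U. card (fibre u \<times> fibre u \<times> fibre u))"
    by (rule card_UN_le) simp
  also have "\<dots> = (\<Sum>u\<in>?U. card (fibre u) ^ 3)"
    by (simp add: card_cartesian_product power_numeral_reduce)
  finally show ?thesis
    using sum_fibre_cubes_le[OF assms] by linarith
qed

end

section \<open>The sixth power of the sum and the energy of triples\<close>

definition unit_exp :: "nat \<Rightarrow> int \<Rightarrow> complex" where
  "unit_exp N x = cis (2 * pi * (of_int x / real N))"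

lemma unit_exp_add: "unit_exp N (x + y) = unit_exp N x * unit_exp N y"
  by (simp add: unit_exp_def cis_mult add_divide_distrib distrib_left)

lemma cnj_unit_exp: "cnj (unit_exp N x) = unit_exp N (- x)"
  by (simp add: unit_exp_def cis_cnj)

lemma unit_exp_mult_nat: "unit_exp N (int n * x) = unit_exp N x ^ n"
  by (simp add: unit_exp_def Complex.DeMoivre mult_ac)

lemma unit_exp_eq_1_iff:
  assumes "N > 0"
  shows "unit_exp N x = 1 \<longleftrightarrow> int N dvd x"
proof -
  have "unit_exp N x = 1 \<longleftrightarrow> (\<exists>n::int. 2 * pi * (of_int x / real N) = of_int n * (2 * pi))"
    unfolding unit_exp_def by (rule cis_eq_1_iff)
  also have "\<dots> \<longleftrightarrow> (\<exists>n::int. real_of_int x = of_int (n * int N))"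
    using assms by (intro arg_cong[where f = Ex]) (auto simp: fun_eq_iff field_simps)
  also have "\<dots> \<longleftrightarrow> int N dvd x"
    by (simp only: of_int_eq_iff) (auto simp: dvd_def mult.commute)
  finally show ?thesis .
qed

lemma unit_exp_cong:
  assumes "N > 0" "[x = y] (mod int N)"
  shows "unit_exp N x = unit_exp N y"
proof -
  have "unit_exp N (x - y) = 1"
    using assms by (simp add: unit_exp_eq_1_iff cong_iff_dvd_diff)
  then show ?thesis using unit_exp_add[of N "x - y" y] by simp
qed

lemma sum_unit_exp:
  assumes "N > 0"
  shows "(\<Sum>x\<in>{0..<int N}. unit_exp N (x * d)) = (if int N dvd d then of_nat N else 0)"
proof -
  have "(\<Sum>x\<in>{0..<int N}. unit_exp N (x * d)) = (\<Sum>n<N. unit_exp N (int n * d))"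
    by (rule sum.reindex_bij_witness[of _ int nat]) auto
  also have "\<dots> = (\<Sum>n<N. unit_exp N d ^ n)" by (simp add: unit_exp_mult_nat)
  also have "\<dots> = (if int N dvd d then of_nat N else 0)"
  proof (cases "int N dvd d")
    case True
    then have "unit_exp N d = 1" using assms by (simp add: unit_exp_eq_1_iff)
    then show ?thesis using True by simp
  next
    case False
    then have "unit_exp N d \<noteq> 1" using assms by (simp add: unit_exp_eq_1_iff)
    then have "(\<Sum>n<N. unit_exp N d ^ n) = (unit_exp N d ^ N - 1) / (unit_exp N d - 1)"
      by (rule geometric_sum)
    also have "unit_exp N d ^ N = 1"
      using assms by (simp add: unit_exp_eq_1_iff flip: unit_exp_mult_nat)
    finally show ?thesis using False by simp
  qed
  finally show ?thesis .
qed

lemma norm_sum_square: "complex_of_real ((norm (\<Sum>v\<in>V. g v)) ^ 2) = (\<Sum>(v, v')\<in>V \<times> V. g v * cnj (g v'))"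
  by (simp only: complex_norm_square cnj_sum sum_product sum.cartesian_product)

lemma sum_card_fibre_square:
  assumes "finite W" "finite R" "x ` W \<subseteq> R"
  shows "(\<Sum>r\<in>R. card {w \<in> W. x w = r} ^ 2) = card {(w, w') \<in> W \<times> W. x w = x w'}"
proof -
  have "card {(w, w') \<in> W \<times> W. x w = x w'} = card (\<Union>r\<in>R. {w \<in> W. x w = r} \<times> {w \<in> W. x w = r})"
    using assms by (intro arg_cong[where f = card]) auto
  also have "\<dots> = (\<Sum>r\<in>R. card ({w \<in> W. x w = r} \<times> {w \<in> W. x w = r}))"
    using assms by (intro card_UN_disjoint) auto
  finally show ?thesis by (simp add: card_cartesian_product power2_eq_square)
qed

text \<open>Group the \<open>w\<close> by residue pairs and apply Cauchy-Schwarz over all pairs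
  modulo \<open>N\<close>. Orthogonality in both coordinates turns the square sum of the inner sums
  into \<open>N ^ 2\<close> times the coincidences among the \<open>v\<close>; \<open>a\<close>
  disappears as a unit.\<close>

lemma bilinear_unit_exp_bound:
  fixes a :: int
  assumes "finite W" "finite V" "N > 0" "coprime a (int N)"
  shows "norm (\<Sum>w\<in>W. \<Sum>v\<in>V. unit_exp N (a * (x w * t v + y w * u v))) ^ 2 \<le>
    real N ^ 2
    * real (card {(w, w') \<in> W \<times> W. [x w = x w'] (mod int N) \<and> [y w = y w'] (mod int N)})
    * real (card {(v, v') \<in> V \<times> V. [t v = t v'] (mod int N) \<and> [u v = u v'] (mod int N)})"
proof -
  define Z where "Z = {0..<int N}"
  define R where "R = Z \<times> Z"
  define red where "red w = (x w mod int N, y w mod int N)" for w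
  define g where "g r = (\<Sum>v\<in>V. unit_exp N (a * (fst r * t v + snd r * u v)))" for r
  have "finite R" by (simp add: R_def Z_def)
  have red: "red ` W \<subseteq> R" using \<open>N > 0\<close> by (auto simp: red_def R_def Z_def)
  have g_red: "(\<Sum>v\<in>V. unit_exp N (a * (x w * t v + y w * u v))) = g (red w)" for w
    unfolding g_def red_def fst_conv snd_conv
    by (intro sum.cong refl unit_exp_cong \<open>N > 0\<close> cong_mult cong_add) (auto simp: cong_def)
  have "norm (\<Sum>w\<in>W. g (red w)) = norm (\<Sum>r\<in>R. \<Sum>w\<in>{w \<in> W. red w = r}. g (red w))"
    using sum.group[OF \<open>finite W\<close> \<open>finite R\<close> red, of "\<lambda>w. g (red w)"] by simp
  also have "\<dots> = norm (\<Sum>r\<in>R. of_nat (card {w \<in> W. red w = r}) * g r)"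
    by simp
  also have "\<dots> \<le> (\<Sum>r\<in>R. norm (of_nat (card {w \<in> W. red w = r}) * g r))"
    by (rule norm_sum)
  also have "\<dots> = (\<Sum>r\<in>R. real (card {w \<in> W. red w = r}) * norm (g r))"
    by (simp add: norm_mult)
  finally have "norm (\<Sum>w\<in>W. g (red w)) ^ 2 \<le>
      (\<Sum>r\<in>R. real (card {w \<in> W. red w = r}) * norm (g r)) ^ 2"
    by (rule power_mono) simp
  also have "\<dots> \<le> (\<Sum>r\<in>R. real (card {w \<in> W. red w = r}) ^ 2) * (\<Sum>r\<in>R. norm (g r) ^ 2)"
    by (rule Cauchy_Schwarz_ineq_sum)
  also have "(\<Sum>r\<in>R. real (card {w \<in> W. red w = r}) ^ 2) =
      real (card {(w, w') \<in> W \<times> W. red w = red w'})"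
    using sum_card_fibre_square[OF \<open>finite W\<close> \<open>finite R\<close> red] by (simp flip: of_nat_power of_nat_sum)
  also have "{(w, w') \<in> W \<times> W. red w = red w'} =
      {(w, w') \<in> W \<times> W. [x w = x w'] (mod int N) \<and> [y w = y w'] (mod int N)}"
    by (auto simp: red_def cong_def)
  also have "(\<Sum>r\<in>R. norm (g r) ^ 2) = real N ^ 2
    * real (card {(v, v') \<in> V \<times> V. [t v = t v'] (mod int N) \<and> [u v = u v'] (mod int N)})"
  proof -
    have "complex_of_real (\<Sum>r\<in>R. norm (g r) ^ 2) = (\<Sum>r\<in>R. \<Sum>(v, v')\<in>V \<times> V.
        unit_exp N (a * (fst r * t v + snd r * u v)) * cnj (unit_exp N (a * (fst r * t v' + snd r * u v'))))"
      unfolding of_real_sum g_def norm_sum_square ..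
    also have "\<dots> = (\<Sum>r\<in>R. \<Sum>(v, v')\<in>V \<times> V. unit_exp N (fst r * (a * (t v - t v'))) *
        unit_exp N (snd r * (a * (u v - u v'))))"
      by (simp add: cnj_unit_exp algebra_simps flip: unit_exp_add)
    also have "\<dots> = (\<Sum>(v, v')\<in>V \<times> V. \<Sum>r\<in>R. unit_exp N (fst r * (a * (t v - t v'))) *
        unit_exp N (snd r * (a * (u v - u v'))))"
      unfolding case_prod_unfold by (rule sum.swap)
    also have "\<dots> = (\<Sum>(v, v')\<in>V \<times> V. (\<Sum>z\<in>Z. unit_exp N (z * (a * (t v - t v')))) *
        (\<Sum>z\<in>Z. unit_exp N (z * (a * (u v - u v')))))"
      unfolding R_def by (simp add: sum_product sum.cartesian_product case_prod_unfold)
    also have "\<dots> = (\<Sum>(v, v')\<in>V \<times> V. if [t v = t v'] (mod int N) \<and> [u v = u v'] (mod int N)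
        then of_nat N ^ 2 else 0)"
    proof -
      have "int N dvd a * d \<longleftrightarrow> int N dvd d" for d
        using assms(4) by (simp add: coprime_commute coprime_dvd_mult_right_iff)
      then show ?thesis
        unfolding Z_def sum_unit_exp[OF \<open>N > 0\<close>]
        by (intro sum.cong) (auto simp: cong_iff_dvd_diff power2_eq_square)
    qed
    also have "\<dots> = complex_of_real (real N ^ 2
        * real (card {(v, v') \<in> V \<times> V. [t v = t v'] (mod int N) \<and> [u v = u v'] (mod int N)}))"
    proof -
      have "{(v, v') \<in> V \<times> V. [t v = t v'] (mod int N) \<and> [u v = u v'] (mod int N)} =
        {z \<in> V \<times> V. [t (fst z) = t (snd z)] (mod int N) \<and> [u (fst z) = u (snd z)] (mod int N)}"
        by auto
      then show ?thesis
        using \<open>finite V\<close> by (simp add: case_prod_unfold sum.inter_filter[symmetric] mult.commute)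
    qed
    finally show ?thesis by (simp only: of_real_eq_iff)
  qed
  finally show ?thesis
    unfolding g_red by (simp add: mult_ac)
qed

section \<open>The group of p-th powers modulo p^2\<close>

text \<open>The cofactor of \<open>x - y\<close> in \<open>x ^ p - y ^ p\<close> is a sum of p terms
  each congruent to \<open>y ^ (p - 1)\<close>, so it contributes a second factor p.\<close>

lemma power_cong_mod_square:
  fixes x y :: int
  assumes "[x = y] (mod int p)"
  shows "[x ^ p = y ^ p] (mod int (p ^ 2))"
proof -
  have "[(\<Sum>i<p. y ^ (p - Suc i) * x ^ i) = (\<Sum>i<p. y ^ (p - Suc i) * y ^ i)] (mod int p)"
    using assms by (intro cong_sum cong_mult cong_pow cong_refl)
  also have "(\<Sum>i<p. y ^ (p - Suc i) * y ^ i) = (\<Sum>i<p. y ^ (p - 1))"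
    by (intro sum.cong) (auto simp flip: power_add)
  also have "[\<dots> = 0] (mod int p)" by (simp add: cong_0_iff)
  finally have "int p dvd (\<Sum>i<p. y ^ (p - Suc i) * x ^ i)" by (simp add: cong_0_iff)
  moreover have "int p dvd x - y" using assms by (simp add: cong_iff_dvd_diff)
  ultimately have "int p * int p dvd (x - y) * (\<Sum>i<p. y ^ (p - Suc i) * x ^ i)"
    by (rule mult_dvd_mono[rotated])
  then show ?thesis
    by (simp add: cong_iff_dvd_diff power_diff_sumr2 power2_eq_square)
qed


lemma mult_mod_in_units:
  assumes "prime p" "m \<in> {1..<int p}" "k \<in> {1..<int p}"
  shows "m * k mod int p \<in> {1..<int p}"
proof -
  have "\<not> int p dvd m" "\<not> int p dvd k" using assms by (auto dest!: zdvd_imp_le)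
  then have "\<not> int p dvd m * k" using assms(1) by (simp add: prime_dvd_mult_iff)
  then have "m * k mod int p \<noteq> 0" by (simp add: dvd_eq_mod_eq_0)
  moreover have "0 \<le> m * k mod int p" "m * k mod int p < int p"
    using assms(1) by (simp_all add: prime_gt_0_nat)
  ultimately show ?thesis by simp
qed

lemma bij_betw_mult_mod:
  assumes "prime p" "k \<in> {1..<int p}"
  shows "bij_betw (\<lambda>m. m * k mod int p) {1..<int p} {1..<int p}"
proof -
  have "inj_on (\<lambda>m. m * k mod int p) {1..<int p}"
  proof (rule inj_onI)
    fix m n assume mn: "m \<in> {1..<int p}" "n \<in> {1..<int p}" "m * k mod int p = n * k mod int p"
    then have "int p dvd (m - n) * k" by (simp add: mod_eq_dvd_iff left_diff_distrib)
    moreover have "\<not> int p dvd k" using assms by (auto dest!: zdvd_imp_le)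
    ultimately have "int p dvd m - n" using assms(1) by (simp add: prime_dvd_mult_iff)
    then have "m mod int p = n mod int p" by (simp add: mod_eq_dvd_iff)
    then show "m = n" using mn by simp
  qed
  moreover have "(\<lambda>m. m * k mod int p) ` {1..<int p} \<subseteq> {1..<int p}"
    using mult_mod_in_units[OF assms(1) _ assms(2)] by blast
  ultimately show ?thesis
    by (simp add: bij_betw_def endo_inj_surj)
qed

definition power_sum :: "nat \<Rightarrow> int \<Rightarrow> complex" where
  "power_sum p a = (\<Sum>m\<in>{1..<int p}. unit_exp (p ^ 2) (a * m ^ p))"

text \<open>Constancy of the row sums: multiplication by \<open>k\<close> permutes the nonzero
  residues modulo p, and p-th powers modulo p^2 depend only on these residues.\<close>

lemma power_sum_dilate:
  assumes "prime p" "k \<in> {1..<int p}"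
  shows "(\<Sum>m\<in>{1..<int p}. unit_exp (p ^ 2) (a * (m ^ p * k ^ p))) = power_sum p a"
proof -
  have "p > 0" using assms(1) by (simp add: prime_gt_0_nat)
  have "[(m * k mod int p) ^ p = m ^ p * k ^ p] (mod int (p ^ 2))" for m
    unfolding power_mult_distrib[symmetric] by (rule power_cong_mod_square) (simp add: cong_def)
  then have "unit_exp (p ^ 2) (a * (m ^ p * k ^ p)) = unit_exp (p ^ 2) (a * (m * k mod int p) ^ p)" for m
    using \<open>p > 0\<close> by (intro unit_exp_cong cong_mult cong_refl) (auto simp: cong_sym_eq)
  then show ?thesis
    unfolding power_sum_def
    using sum.reindex_bij_betw[OF bij_betw_mult_mod[OF assms], of "\<lambda>m. unit_exp (p ^ 2) (a * m ^ p)"]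
    by simp
qed

definition triple_energy_set :: "nat \<Rightarrow> ((int \<times> int \<times> int) \<times> (int \<times> int \<times> int)) set" where
  "triple_energy_set p = {((m\<^sub>1, m\<^sub>2, m\<^sub>3), (n\<^sub>1, n\<^sub>2, n\<^sub>3)).
     {m\<^sub>1, m\<^sub>2, m\<^sub>3, n\<^sub>1, n\<^sub>2, n\<^sub>3} \<subseteq> {1..<int p} \<and>
     [m\<^sub>1 ^ p - n\<^sub>1 ^ p = m\<^sub>2 ^ p - n\<^sub>2 ^ p] (mod int (p ^ 2)) \<and>
     [m\<^sub>1 ^ p - n\<^sub>1 ^ p = m\<^sub>3 ^ p - n\<^sub>3 ^ p] (mod int (p ^ 2))}"

lemma finite_triple_energy_set: "finite (triple_energy_set p)"
proof (rule finite_subset)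
  let ?M = "{1..<int p}"
  show "triple_energy_set p \<subseteq> (?M \<times> ?M \<times> ?M) \<times> (?M \<times> ?M \<times> ?M)"
    unfolding triple_energy_set_def by auto
qed auto

lemma power_sum_sixth_power_le:
  assumes "prime p" "\<not> int p dvd a"
  shows "norm (power_sum p a) ^ 6 \<le> real p ^ 2 * real (card (triple_energy_set p))"
proof -
  define M where "M = {1..<int p}"
  define N where "N = p ^ 2"
  define E where "E m k = unit_exp N (a * (m ^ p * k ^ p))" for m k
  \<comment> \<open>\<open>B\<close> is the product M M^* M for the matrix M = \<open>E\<close>;
    constant row and column sums of M give the sum of its entries.\<close>
  define B where "B m n = (\<Sum>k\<in>M. \<Sum>l\<in>M. E m k * cnj (E l k) * E l n)" for m n
  define S where "S = power_sum p a"
  define t where "t = card M"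
  have "p > 1" using assms(1) by (rule prime_gt_1_nat)
  have "finite M" "t > 0" "N > 0" using \<open>p > 1\<close> by (simp_all add: M_def t_def N_def)
  have "coprime (int p) a" using assms by (intro prime_imp_coprime) auto
  then have "coprime a (int N)" by (simp add: N_def coprime_commute)
  have E1: "(\<Sum>m\<in>M. E m k) = S" if "k \<in> M" for k
    using power_sum_dilate[OF assms(1), of k a] that by (simp add: M_def E_def S_def N_def)
  have E_sym: "E m k = E k m" for m k by (simp add: E_def mult.commute)
  have E2: "(\<Sum>n\<in>M. E l n) = S" if "l \<in> M" for l
    using E1[OF that] by (simp only: E_sym[of l])
  have "(\<Sum>m\<in>M. \<Sum>n\<in>M. B m n) = (\<Sum>k\<in>M. \<Sum>l\<in>M. (\<Sum>m\<in>M. E m k) * cnj (E l k) * (\<Sum>n\<in>M. E l n))"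
  proof -
    have "(\<Sum>m\<in>M. \<Sum>n\<in>M. B m n) = (\<Sum>m\<in>M. \<Sum>k\<in>M. \<Sum>n\<in>M. \<Sum>l\<in>M. E m k * cnj (E l k) * E l n)"
      unfolding B_def by (intro sum.cong refl sum.swap)
    also have "\<dots> = (\<Sum>k\<in>M. \<Sum>m\<in>M. \<Sum>n\<in>M. \<Sum>l\<in>M. E m k * cnj (E l k) * E l n)"
      by (rule sum.swap)
    also have "\<dots> = (\<Sum>k\<in>M. \<Sum>m\<in>M. \<Sum>l\<in>M. \<Sum>n\<in>M. E m k * cnj (E l k) * E l n)"
      by (intro sum.cong refl sum.swap)
    also have "\<dots> = (\<Sum>k\<in>M. \<Sum>l\<in>M. \<Sum>m\<in>M. \<Sum>n\<in>M. E m k * cnj (E l k) * E l n)"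
      by (intro sum.cong refl sum.swap)
    also have "\<dots> = (\<Sum>k\<in>M. \<Sum>l\<in>M. \<Sum>n\<in>M. \<Sum>m\<in>M. E m k * cnj (E l k) * E l n)"
      by (intro sum.cong refl sum.swap)
    also have "\<dots> = (\<Sum>k\<in>M. \<Sum>l\<in>M. (\<Sum>m\<in>M. E m k) * cnj (E l k) * (\<Sum>n\<in>M. E l n))"
      by (simp add: sum_distrib_left sum_distrib_right)
    finally show ?thesis .
  qed
  also have "\<dots> = (\<Sum>k\<in>M. \<Sum>l\<in>M. S * cnj (E l k) * S)"
    by (intro sum.cong refl) (simp add: E1 E2)
  also have "\<dots> = (\<Sum>k\<in>M. S * cnj (\<Sum>l\<in>M. E l k) * S)"
    by (simp add: sum_distrib_left sum_distrib_right)
  also have "\<dots> = of_nat t * (S * cnj S * S)"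
    by (simp add: E1 t_def)
  finally have sum_B: "(\<Sum>(m, n)\<in>M \<times> M. B m n) = of_nat t * (S * cnj S * S)"
    by (simp add: sum.cartesian_product)
  \<comment> \<open>Cauchy-Schwarz over the t^2 entries of \<open>B\<close>.\<close>
  have "(real t * norm S ^ 3) ^ 2 = norm (\<Sum>(m, n)\<in>M \<times> M. B m n) ^ 2"
    by (simp add: sum_B norm_mult power_numeral_reduce)
  also have "\<dots> \<le> (\<Sum>(m, n)\<in>M \<times> M. norm (B m n)) ^ 2"
    by (intro power_mono order.trans[OF norm_sum]) (simp_all add: case_prod_unfold)
  also have "\<dots> \<le> (\<Sum>(m, n)\<in>M \<times> M. norm (B m n) ^ 2) * real (t ^ 2)"
    using sum_squared_le_sum_of_squares[of "\<lambda>(m, n). norm (B m n)" "M \<times> M"]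
    by (simp add: case_prod_unfold t_def card_cartesian_product power2_eq_square)
  finally have "real t ^ 2 * norm S ^ 6 \<le> real t ^ 2 * (\<Sum>(m, n)\<in>M \<times> M. norm (B m n) ^ 2)"
    by (simp add: power_mult_distrib mult.commute flip: power_mult)
  then have S6: "norm S ^ 6 \<le> (\<Sum>(m, n)\<in>M \<times> M. norm (B m n) ^ 2)"
    using \<open>t > 0\<close> by simp

  \<comment> \<open>Written in p-th powers, the phase in the expanded square sum of \<open>B\<close>
    is m k - l k + l n - m k' + l' k' - l' n, which equals (m - l')(k - k') + (l - l')(n - k).
    Grouping the variables as (m, l, l') and (k, k', n) gives the bilinear form.\<close>
  define W where "W = M \<times> M \<times> M"
  define x where "x = (\<lambda>(m, l::int, l'). (m::int) ^ p - l' ^ p :: int)"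
  define y where "y = (\<lambda>(m::int, l, l'). l ^ p - l' ^ p :: int)"
  define u where "u = (\<lambda>(k, k', n::int). (k::int) ^ p - k' ^ p :: int)"
  define v where "v = (\<lambda>(k, k'::int, n). n ^ p - (k::int) ^ p :: int)"
  define H where "H = (\<Sum>w\<in>W. \<Sum>z\<in>W. unit_exp N (a * (x w * u z + y w * v z)))"
  have "complex_of_real (\<Sum>(m, n)\<in>M \<times> M. norm (B m n) ^ 2) = H"
  proof -
    have "complex_of_real (\<Sum>(m, n)\<in>M \<times> M. norm (B m n) ^ 2) =
        (\<Sum>(m, n)\<in>M \<times> M. \<Sum>((k, l), (k', l'))\<in>(M \<times> M) \<times> (M \<times> M).
          (E m k * cnj (E l k) * E l n) * cnj (E m k' * cnj (E l' k') * E l' n))"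
      unfolding of_real_sum case_prod_unfold B_def sum.cartesian_product norm_sum_square ..
    also have "\<dots> = (\<Sum>((m, n), (k, l), (k', l'))\<in>(M \<times> M) \<times> (M \<times> M) \<times> (M \<times> M).
          (E m k * cnj (E l k) * E l n) * cnj (E m k' * cnj (E l' k') * E l' n))"
      by (simp add: sum.cartesian_product case_prod_unfold)
    also have "\<dots> = (\<Sum>(w, z)\<in>W \<times> W. unit_exp N (a * (x w * u z + y w * v z)))"
      by (rule sum.reindex_bij_witness[
            where i = "\<lambda>((m, l, l'), (k, k', n)). ((m, n), (k, l), (k', l'))"
              and j = "\<lambda>((m, n), (k, l), (k', l')). ((m, l, l'), (k, k', n))"])
        (auto simp: W_def x_def y_def u_def v_def E_def cnj_unit_exp algebra_simps
          simp flip: unit_exp_add)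
    finally show ?thesis by (simp add: H_def sum.cartesian_product)
  qed
  then have "(\<Sum>(m, n)\<in>M \<times> M. norm (B m n) ^ 2) = norm H"
    by (metis (no_types, lifting) abs_of_nonneg case_prod_unfold norm_of_real sum_nonneg zero_le_power2)
  with S6 have "(norm S ^ 6) ^ 2 \<le> norm H ^ 2" by (intro power_mono) auto
  also have "\<dots> \<le> real N ^ 2
    * real (card {(w, w') \<in> W \<times> W. [x w = x w'] (mod int N) \<and> [y w = y w'] (mod int N)})
    * real (card {(z, z') \<in> W \<times> W. [u z = u z'] (mod int N) \<and> [v z = v z'] (mod int N)})"
    unfolding H_def
    by (rule bilinear_unit_exp_bound) (simp_all add: W_def \<open>finite M\<close> \<open>N > 0\<close> \<open>coprime a (int N)\<close>)
  also have "\<dots> \<le> real N ^ 2 * real (card (triple_energy_set p)) * real (card (triple_energy_set p))"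
  proof (intro mult_mono of_nat_mono card_mono finite_triple_energy_set)
    \<comment> \<open>Agreement of both linear forms at two triples says that the three
      componentwise differences of p-th powers agree: an energy solution.\<close>
    have *: "[b - c = b' - c'] (mod int N) \<Longrightarrow> [b - b' = c - c'] (mod int N)" for b c b' c' :: int
      by (simp add: cong_iff_dvd_diff algebra_simps)
    have **: "[c - c' = b - b'] (mod int N)" if "[b - c = b' - c'] (mod int N)" for b c b' c' :: int
      using *[OF that] by (rule cong_sym)
    have ***: "[b - b' = d - d'] (mod int N)"
      if "[b - c = b' - c'] (mod int N)" "[d - c = d' - c'] (mod int N)" for b c d b' c' d' :: int
      using *[OF that(1)] **[OF that(2)] by (rule cong_trans)
    show "{(w, w') \<in> W \<times> W. [x w = x w'] (mod int N) \<and> [y w = y w'] (mod int N)}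
        \<subseteq> triple_energy_set p"
      unfolding triple_energy_set_def N_def[symmetric] W_def M_def x_def y_def
      by (auto intro: * ** ***)
    show "{(z, z') \<in> W \<times> W. [u z = u z'] (mod int N) \<and> [v z = v z'] (mod int N)}
        \<subseteq> triple_energy_set p"
      unfolding triple_energy_set_def N_def[symmetric] W_def M_def u_def v_def
      by (auto intro: * ** ***)
  qed auto
  finally have "(norm S ^ 6) ^ 2 \<le> (real p ^ 2 * real (card (triple_energy_set p))) ^ 2"
    by (simp add: N_def power2_eq_square mult_ac)
  then show ?thesis
    unfolding S_def by (rule power2_le_imp_le) simp
qed


section \<open>The energy in terms of the fibres of f\<close>

context heilbronn_poly
begin

text \<open>Take k = m / s modulo p; then k - 1 = n / s, and k avoids 0 and 1 as m and n are
  nonzero. Passing to p-th powers modulo p^2 and factoring out \<open>s ^ p\<close> leaves k^p -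
  (k-1)^p, which is 1 - p f(k).\<close>

lemma difference_parametrization:
  assumes "m \<in> {1..<int p}" "n \<in> {1..<int p}" "s \<in> {1..<int p}" "[m - n = s] (mod int p)"
  obtains k where "k \<in> {2..<int p}" "m = k * s mod int p" "n = (k - 1) * s mod int p"
    "[m ^ p - n ^ p = s ^ p * (1 - int p * poly f k)] (mod int (p ^ 2))"
proof -
  have "\<not> int p dvd s" using assms(3) by (auto dest!: zdvd_imp_le)
  then have "coprime s (int p)"
    using prime_p by (metis coprime_commute prime_imp_coprime prime_nat_int_transfer)
  then obtain t where t: "[s * t = 1] (mod int p)" using cong_solve_coprime_int by blast
  define k where "k = m * t mod int p"
  have "[k * s = m * t * s] (mod int p)" unfolding k_def by (intro cong_mult cong_refl) (simp add: cong_def)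
  also have "m * t * s = m * (s * t)" by simp
  also have "[\<dots> = m * 1] (mod int p)" using t by (intro cong_mult cong_refl)
  finally have ks: "[k * s = m] (mod int p)" by simp
  then have "[k * s - s = m - (m - n)] (mod int p)"
    using cong_sym[OF assms(4)] by (rule cong_diff)
  then have ks': "[(k - 1) * s = n] (mod int p)" by (simp add: left_diff_distrib)
  have m: "m = k * s mod int p" and n: "n = (k - 1) * s mod int p"
    using ks ks' assms(1,2) by (simp_all add: cong_def)
  have "k \<noteq> 0" "k \<noteq> 1" using m n assms(1,2) by auto
  moreover have "0 \<le> k" "k < int p" using p_pos by (simp_all add: k_def)
  ultimately have "k \<in> {2..<int p}" by simp
  moreover have "[m ^ p - n ^ p = (k * s) ^ p - ((k - 1) * s) ^ p] (mod int (p ^ 2))"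
    using ks ks' by (intro cong_diff power_cong_mod_square) (simp_all add: cong_sym)
  moreover have "(k * s) ^ p - ((k - 1) * s) ^ p = s ^ p * (1 - int p * poly f k)"
  proof -
    have "int p * poly f k = 1 - k ^ p + (k - 1) ^ p"
      using arg_cong[OF p_times_f, of "\<lambda>P. poly P k"] by simp
    then have "k ^ p - (k - 1) ^ p = 1 - int p * poly f k" by simp
    moreover have "(k * s) ^ p - ((k - 1) * s) ^ p = s ^ p * (k ^ p - (k - 1) ^ p)"
      by (simp only: power_mult_distrib) (simp add: algebra_simps)
    ultimately show ?thesis by (simp only:)
  qed
  ultimately show ?thesis using m n that by simp
qed

lemma same_value_of_cong:
  assumes "s \<in> {1..<int p}"
    and "[s ^ p * (1 - int p * x) = s ^ p * (1 - int p * y)] (mod int (p ^ 2))"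
  shows "int p dvd x - y"
proof -
  have "int p * int p dvd int p * (s ^ p * (y - x))"
    using assms(2) by (simp add: cong_iff_dvd_diff power2_eq_square algebra_simps)
  then have "int p dvd s ^ p * (y - x)" using p_pos by simp
  moreover have "\<not> int p dvd s" using assms(1) by (auto dest!: zdvd_imp_le)
  then have "\<not> int p dvd s ^ p" using prime_p by (simp add: prime_dvd_power_iff p_pos)
  ultimately have "int p dvd y - x" using prime_p by (simp add: prime_dvd_mult_iff)
  then show ?thesis by (simp add: dvd_diff_commute)
qed

lemma cong_of_power_cong:
  assumes "[m ^ p - n ^ p = m' ^ p - n' ^ p] (mod int (p ^ 2))"
  shows "[m - n = m' - n'] (mod int p)"
proof -
  have F: "[k ^ p = k] (mod int p)" for k using fermat by (simp add: cong_iff_dvd_diff)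
  have "[m ^ p - n ^ p = m' ^ p - n' ^ p] (mod int p)"
    using assms by (rule cong_dvd_modulus) (simp add: power2_eq_square)
  then show ?thesis
    using F by (meson cong_diff cong_sym cong_trans)
qed

text \<open>By Fermat the three differences of a solution share one residue s modulo p. If s = 0 the
  solution is diagonal, giving at most p^3; otherwise s and three parameters with equal values of
  \<open>f\<close> modulo p determine it.\<close>

lemma card_triple_energy_set_le:
  "card (triple_energy_set p) \<le> p ^ 3 + p * card {(k\<^sub>1, k\<^sub>2, k\<^sub>3). {k\<^sub>1, k\<^sub>2, k\<^sub>3} \<subseteq> {2..<int p} \<and>
      int p dvd poly f k\<^sub>1 - poly f k\<^sub>2 \<and> int p dvd poly f k\<^sub>1 - poly f k\<^sub>3}"
    (is "_ \<le> _ + p * card ?T")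
proof -
  let ?M = "{1..<int p}"
  let ?g = "\<lambda>w::int \<times> int \<times> int. (w, w)"
  let ?h = "\<lambda>(s, k\<^sub>1, k\<^sub>2, k\<^sub>3). ((k\<^sub>1 * s mod int p, k\<^sub>2 * s mod int p, k\<^sub>3 * s mod int p),
     ((k\<^sub>1 - 1) * s mod int p, (k\<^sub>2 - 1) * s mod int p, (k\<^sub>3 - 1) * s mod int p))"
  have card_M: "card ?M = p - 1" using p_pos by (simp add: nat_diff_distrib)
  have "finite ?T"
    by (rule finite_subset[of _ "{2..<int p} \<times> {2..<int p} \<times> {2..<int p}"]) auto
  have "triple_energy_set p \<subseteq> ?g ` (?M \<times> ?M \<times> ?M) \<union> ?h ` (?M \<times> ?T)"
  proof
    fix z assume "z \<in> triple_energy_set p"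
    then obtain m\<^sub>1 m\<^sub>2 m\<^sub>3 n\<^sub>1 n\<^sub>2 n\<^sub>3 where z: "z = ((m\<^sub>1, m\<^sub>2, m\<^sub>3), (n\<^sub>1, n\<^sub>2, n\<^sub>3))"
      and M: "m\<^sub>1 \<in> ?M" "m\<^sub>2 \<in> ?M" "m\<^sub>3 \<in> ?M" "n\<^sub>1 \<in> ?M" "n\<^sub>2 \<in> ?M" "n\<^sub>3 \<in> ?M"
      and c2: "[m\<^sub>1 ^ p - n\<^sub>1 ^ p = m\<^sub>2 ^ p - n\<^sub>2 ^ p] (mod int (p ^ 2))"
      and c3: "[m\<^sub>1 ^ p - n\<^sub>1 ^ p = m\<^sub>3 ^ p - n\<^sub>3 ^ p] (mod int (p ^ 2))"
      unfolding triple_energy_set_def by auto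
    note c2' = cong_of_power_cong[OF c2] and c3' = cong_of_power_cong[OF c3]
    show "z \<in> ?g ` (?M \<times> ?M \<times> ?M) \<union> ?h ` (?M \<times> ?T)"
    proof (cases "m\<^sub>1 = n\<^sub>1")
      case True
      then have "[m\<^sub>2 = n\<^sub>2] (mod int p)" "[m\<^sub>3 = n\<^sub>3] (mod int p)"
        using c2' c3' by (simp_all add: cong_iff_dvd_diff dvd_diff_commute)
      then have "m\<^sub>2 = n\<^sub>2" "m\<^sub>3 = n\<^sub>3" using M by (simp_all add: cong_def)
      then have "z = ?g (m\<^sub>1, m\<^sub>2, m\<^sub>3)" using True z by simp
      then show ?thesis using M by blast
    next
      case False
      define s where "s = (m\<^sub>1 - n\<^sub>1) mod int p"
      have "\<not> [m\<^sub>1 = n\<^sub>1] (mod int p)" using False M by (simp add: cong_def)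
      then have "s \<noteq> 0" by (simp add: s_def cong_iff_dvd_diff dvd_eq_mod_eq_0)
      moreover have "0 \<le> s" "s < int p" using p_pos by (simp_all add: s_def)
      ultimately have s: "s \<in> ?M" by simp
      have d1: "[m\<^sub>1 - n\<^sub>1 = s] (mod int p)" by (simp add: s_def cong_def)
      have d2: "[m\<^sub>2 - n\<^sub>2 = s] (mod int p)" and d3: "[m\<^sub>3 - n\<^sub>3 = s] (mod int p)"
        using c2' c3' d1 by (metis cong_sym cong_trans)+
      obtain k\<^sub>1 where k\<^sub>1: "k\<^sub>1 \<in> {2..<int p}" "m\<^sub>1 = k\<^sub>1 * s mod int p" "n\<^sub>1 = (k\<^sub>1 - 1) * s mod int p"
        "[m\<^sub>1 ^ p - n\<^sub>1 ^ p = s ^ p * (1 - int p * poly f k\<^sub>1)] (mod int (p ^ 2))"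
        using difference_parametrization[OF M(1,4) s d1] by blast
      obtain k\<^sub>2 where k\<^sub>2: "k\<^sub>2 \<in> {2..<int p}" "m\<^sub>2 = k\<^sub>2 * s mod int p" "n\<^sub>2 = (k\<^sub>2 - 1) * s mod int p"
        "[m\<^sub>2 ^ p - n\<^sub>2 ^ p = s ^ p * (1 - int p * poly f k\<^sub>2)] (mod int (p ^ 2))"
        using difference_parametrization[OF M(2,5) s d2] by blast
      obtain k\<^sub>3 where k\<^sub>3: "k\<^sub>3 \<in> {2..<int p}" "m\<^sub>3 = k\<^sub>3 * s mod int p" "n\<^sub>3 = (k\<^sub>3 - 1) * s mod int p"
        "[m\<^sub>3 ^ p - n\<^sub>3 ^ p = s ^ p * (1 - int p * poly f k\<^sub>3)] (mod int (p ^ 2))"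
        using difference_parametrization[OF M(3,6) s d3] by blast
      have "int p dvd poly f k\<^sub>1 - poly f k\<^sub>2"
        using k\<^sub>1(4) k\<^sub>2(4) c2 by (intro same_value_of_cong[OF s]) (meson cong_sym cong_trans)
      moreover have "int p dvd poly f k\<^sub>1 - poly f k\<^sub>3"
        using k\<^sub>1(4) k\<^sub>3(4) c3 by (intro same_value_of_cong[OF s]) (meson cong_sym cong_trans)
      ultimately have "(s, k\<^sub>1, k\<^sub>2, k\<^sub>3) \<in> ?M \<times> ?T" using s k\<^sub>1(1) k\<^sub>2(1) k\<^sub>3(1) by simp
      moreover have "z = ?h (s, k\<^sub>1, k\<^sub>2, k\<^sub>3)" using z k\<^sub>1(2,3) k\<^sub>2(2,3) k\<^sub>3(2,3) by simp
      ultimately show ?thesis by blast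
    qed
  qed
  then have "card (triple_energy_set p) \<le> card (?g ` (?M \<times> ?M \<times> ?M) \<union> ?h ` (?M \<times> ?T))"
    using \<open>finite ?T\<close> by (intro card_mono) auto
  also have "\<dots> \<le> card (?g ` (?M \<times> ?M \<times> ?M)) + card (?h ` (?M \<times> ?T))"
    by (rule card_Un_le)
  also have "\<dots> \<le> card (?M \<times> ?M \<times> ?M) + card (?M \<times> ?T)"
    using \<open>finite ?T\<close> by (intro add_mono card_image_le) auto
  also have "\<dots> = (p - 1) ^ 3 + (p - 1) * card ?T"
    by (simp only: card_cartesian_product card_M power3_eq_cube mult.assoc)
  also have "\<dots> \<le> p ^ 3 + p * card ?T"
    by (intro add_mono power_mono mult_right_mono) auto
  finally show ?thesis .
qed

lemma power_sum_sixth_power_le_log: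
  assumes "p \<ge> 256" "\<not> int p dvd a"
  shows "norm (power_sum p a) ^ 6 \<le> (1 + 6 * 48 ^ 3) * real p ^ 5 * log 2 (real p)"
proof -
  define T where "T = card {(k\<^sub>1, k\<^sub>2, k\<^sub>3). {k\<^sub>1, k\<^sub>2, k\<^sub>3} \<subseteq> {2..<int p} \<and>
      int p dvd poly f k\<^sub>1 - poly f k\<^sub>2 \<and> int p dvd poly f k\<^sub>1 - poly f k\<^sub>3}"
  have log1: "1 \<le> log 2 (real p)" using assms(1) by (simp add: le_log_iff)
  have "ln (real p) \<le> log 2 (real p)"
    using assms(1) ln_2_less_1 by (simp add: log_def field_simps mult_left_le)
  \<comment> \<open>This doubles the constant 3 * 48^3; the added 1 in the final constant comes from
    the diagonal term p^3.\<close>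
  then have "1 + ln (real p) \<le> 2 * log 2 (real p)" using log1 by linarith
  then have "3 * 48 ^ 3 * real p ^ 2 * (1 + ln (real p)) \<le> 3 * 48 ^ 3 * real p ^ 2 * (2 * log 2 (real p))"
    by (intro mult_left_mono) auto
  then have T: "real T \<le> 6 * 48 ^ 3 * real p ^ 2 * log 2 (real p)"
    using card_triples_same_value_le[OF assms(1)] unfolding T_def by linarith
  have "norm (power_sum p a) ^ 6 \<le> real p ^ 2 * real (card (triple_energy_set p))"
    by (rule power_sum_sixth_power_le[OF prime_p assms(2)])
  also have "\<dots> \<le> real p ^ 2 * real (p ^ 3 + p * T)"
    using card_triple_energy_set_le unfolding T_def by (intro mult_left_mono of_nat_mono) auto
  also have "\<dots> = real p ^ 5 * 1 + real p ^ 3 * real T"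
    by (simp add: power_numeral_reduce algebra_simps)
  also have "\<dots> \<le> real p ^ 5 * log 2 (real p) + real p ^ 3 * (6 * 48 ^ 3 * real p ^ 2 * log 2 (real p))"
    using T log1 by (intro add_mono mult_left_mono) auto
  also have "\<dots> = (1 + 6 * 48 ^ 3) * real p ^ 5 * log 2 (real p)"
    by (simp add: power_numeral_reduce algebra_simps)
  finally show ?thesis .
qed

end

section \<open>From the power sum to the Heilbronn sum\<close>

text \<open>The extra term \<open>n = p\<close> equals 1, since p^2 divides p^p.\<close>

lemma heilbronn_sum_eq:
  assumes "prime p"
  shows "heilbronn_sum p a = power_sum p a + 1"
proof -
  have "p > 0" using assms by (rule prime_gt_0_nat)
  have "exp (2 * of_real pi * \<i> * of_int a * of_nat n ^ p / of_nat p ^ 2) =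
      unit_exp (p ^ 2) (a * int n ^ p)" for n
    by (simp add: unit_exp_def cis_conv_exp mult_ac)
  then have "heilbronn_sum p a = (\<Sum>n=1..p. unit_exp (p ^ 2) (a * int n ^ p))"
    by (simp add: heilbronn_sum_def)
  also have "{1..p} = insert p {1..<p}" using \<open>p > 0\<close> by auto
  also have "(\<Sum>n\<in>\<dots>. unit_exp (p ^ 2) (a * int n ^ p)) =
      unit_exp (p ^ 2) (a * int p ^ p) + (\<Sum>n=1..<p. unit_exp (p ^ 2) (a * int n ^ p))"
    by simp
  also have "unit_exp (p ^ 2) (a * int p ^ p) = 1"
    using \<open>p > 0\<close> prime_ge_2_nat[OF assms]
    by (subst unit_exp_eq_1_iff) (auto intro: dvd_mult le_imp_power_dvd)
  also have "(\<Sum>n=1..<p. unit_exp (p ^ 2) (a * int n ^ p)) = power_sum p a"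
    unfolding power_sum_def by (rule sum.reindex_bij_witness[of _ nat int]) auto
  finally show ?thesis by simp
qed

lemma norm_heilbronn_sum_le: "norm (heilbronn_sum p a) \<le> real p"
proof -
  have "norm (exp (2 * of_real pi * \<i> * of_int a * of_nat n ^ p / of_nat p ^ 2)) = 1" for n
    by (simp flip: of_nat_power of_nat_mult)
  then have "norm (heilbronn_sum p a) \<le> (\<Sum>n=1..p. 1)"
    unfolding heilbronn_sum_def by (intro sum_norm_le) (simp only: order_refl)
  then show ?thesis by simp
qed

theorem theorem16:
  shows "\<exists>C::real. C > 0 \<and>
    (\<forall>(p::nat) (a::int). prime p \<longrightarrow> \<not> [a = 0] (mod int p) \<longrightarrow>
       norm (heilbronn_sum p a) \<le> C * (real p powr (5 / 6) * log 2 (real p) powr (1 / 6)))"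
proof (intro exI conjI allI impI)
  \<comment> \<open>The summand 256 serves small primes through the trivial bound, and for large
    ones absorbs the term \<open>n = p\<close>, as 1 is at most \<open>Y\<close>.\<close>
  define c :: real where "c = 1 + 6 * 48 ^ 3"
  show "(c + 256 :: real) > 0" by (simp add: c_def)
  fix p :: nat and a :: int
  assume p: "prime p" and a: "\<not> [a = 0] (mod int p)"
  define L where "L = log 2 (real p)"
  define Y where "Y = real p powr (5 / 6) * L powr (1 / 6)"
  have "p \<ge> 2" using p by (rule prime_ge_2_nat)
  then have "L \<ge> 1" by (simp add: L_def le_log_iff)
  then have "1 * 1 \<le> Y"
    unfolding Y_def using \<open>p \<ge> 2\<close> by (intro mult_mono ge_one_powr_ge_zero) auto
  then have "Y \<ge> 1" by simp
  have "norm (heilbronn_sum p a) \<le> (c + 256) * Y"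
  proof (cases "p \<ge> 256")
    case False
    have "norm (heilbronn_sum p a) \<le> 256 * 1"
      using norm_heilbronn_sum_le[of p a] False by simp
    also have "\<dots> \<le> (c + 256) * Y"
      using \<open>Y \<ge> 1\<close> by (intro mult_mono) (auto simp: c_def)
    finally show ?thesis .
  next
    case True
    have "odd p" using prime_odd_nat[OF p] True by linarith
    obtain f where f: "1 - X ^ p + (X - 1) ^ p = of_nat p * f"
      using prime_dvd_one_minus_power_plus[OF p \<open>odd p\<close>] by (rule dvdE)
    have "heilbronn_poly p f"
      by (rule heilbronn_poly.intro[OF p \<open>odd p\<close> f[symmetric]])
    have Y6: "Y ^ 6 = real p ^ 5 * L"
    proof -
      have root6: "(x powr (r / 6)) ^ 6 = x powr r" if "x > 0" for x r :: real
      proof -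
        have "(x powr (r / 6)) ^ 6 = (x powr (r / 6)) powr real 6"
          using that by (intro powr_realpow[symmetric]) simp
        also have "\<dots> = x powr (r / 6 * real 6)" by (rule powr_powr)
        finally show ?thesis by simp
      qed
      have "(real p powr (5 / 6)) ^ 6 = real p powr 5" "(L powr (1 / 6)) ^ 6 = L powr 1"
        using \<open>p \<ge> 2\<close> \<open>L \<ge> 1\<close> by (intro root6; simp)+
      then show ?thesis
        using \<open>p \<ge> 2\<close> \<open>L \<ge> 1\<close> by (simp add: Y_def power_mult_distrib powr_numeral)
    qed
    \<comment> \<open>As c \<ge> 1, enlarging c to c^6 makes the bound a perfect sixth
      power.\<close>
    have "c ^ 1 \<le> c ^ 6" by (rule power_increasing) (simp_all add: c_def)
    have "norm (power_sum p a) ^ 6 \<le> c * real p ^ 5 * L"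
      using heilbronn_poly.power_sum_sixth_power_le_log[OF \<open>heilbronn_poly p f\<close> True, of a] a
      by (simp add: c_def L_def cong_0_iff)
    also have "\<dots> = c * Y ^ 6" by (simp add: Y6)
    also have "\<dots> \<le> c ^ 6 * Y ^ 6"
      using \<open>c ^ 1 \<le> c ^ 6\<close> by (intro mult_right_mono) auto
    also have "\<dots> = (c * Y) ^ 6" by (simp add: power_mult_distrib)
    finally have "norm (power_sum p a) \<le> c * Y"
      using \<open>Y \<ge> 1\<close> by (subst (asm) power_mono_iff) (auto simp: c_def)
    moreover have "norm (heilbronn_sum p a) \<le> norm (power_sum p a) + 1"
      using norm_triangle_ineq[of "power_sum p a" 1] by (simp add: heilbronn_sum_eq[OF p])
    ultimately have "norm (heilbronn_sum p a) \<le> c * Y + Y" using \<open>Y \<ge> 1\<close> by linarith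
    also have "\<dots> \<le> (c + 256) * Y" using \<open>Y \<ge> 1\<close> by (simp add: algebra_simps)
    finally show ?thesis .
  qed
  then show "norm (heilbronn_sum p a) \<le> (c + 256) * (real p powr (5 / 6) * log 2 (real p) powr (1 / 6))"
    by (simp only: Y_def L_def)
qed

end
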